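(* Let $N\in{}^*\mathbb{N}$ be infinite, $V\subseteq[1,N]$ a multiplicative cut, $k\in{}^*\mathbb{N}$, $A$ an internal subset of $[k,Nk]$, and $X=\varphi_V(A)$. Then $\mathfrak{m}_{k,N,V}$-almost every point of $X$ is a Lebesgue density point of $X$.
   Context: Work in a countably saturated nonstandard extension; ${}^*\mathbb{N}$ are the hypernaturals, $\mathrm{st}$ the standard part, intervals $[a,b]$ are sets of hypernaturals. A multiplicative cut is an infinite initial segment $V$ of ${}^*\mathbb{N}$ with $V\cdot V\subseteq V$; for $r\in{}^*\mathbb{N}$, "$r>V$" means $r\notin V$. For $a\le b$ in ${}^*\mathbb{N}$ put $a\sim_V b$ iff $\lfloor b/a\rfloor\in V$ (the paper defines this as $|\lfloor\ln a\rfloor-\lfloor\ln b\rfloor|\in\{x:\lfloor e^x\rfloor\in V\}$ and notes the equivalence); $[a]^V$ is the class of $a$, $\varphi_V(a)=[a]^V$; classes are multiplied by $[a]^V[b]^V=[ab]^V$ and ordered by $[a]^V<[b]^V$ iff $a<b$ and $a\not\sim_V b$. For $k\in{}^*\mathbb{N}$ and infinite $M$, $\nu_{k,M}$ is the Loeb measure on $[k,Mk]$ induced by $C\mapsto\mathrm{st}(\sum_{a\in C}\frac{1}{a\ln M})$ on internal $C\subseteq[k,Mk]$; $\mathcal{H}_{k,M,V}=\varphi_V([k,Mk])$ with measure $\mathfrak{m}_{k,M,V}(E)=\nu_{k,M}(\varphi_V^{-1}(E)\cap[k,Mk])$ for those $E$ for which this preimage is Loeb measurable. For $x\in\mathcal{H}_{k,N,V}$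 and $r>V$, $\mathfrak{m}_{x,r,V}(X)$ denotes $\mathfrak{m}_{b,r,V}(X\cap[x,\varphi_V(r)x])$ for any $b\in\varphi_V^{-1}(\{x\})$ (independent of the choice of $b$). Set $\delta_+(x,X)=\sup_{s>V}\inf_{V<r<s}\mathfrak{m}_{x,r,V}(X)$ and, analogously on the left, $\delta_-(x,X)=\sup_{s>V}\inf_{V<r<s}\mathfrak{m}_{b',r,V}(X\cap[\varphi_V(r)^{-1}x,x])$ where $b'=\lfloor b/r\rfloor$ for $b\in\varphi_V^{-1}(\{x\})$. A point $x$ is a Lebesgue density point of $X$ if $\delta_+(x,X)=\delta_-(x,X)=1$. *)

theory Defs
  imports "HOL-Analysis.Analysis"
begin

text \<open>
  The standard universe has the three sorts the theory speaks about: natural numbers, sets of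
  natural numbers and real numbers. Standard relations of arity \<open>m\<close> on it are sets of lists of
  length \<open>m\<close>. A nonstandard extension assigns to every standard relation \<open>A\<close> a relation
  \<open>star A\<close> on the extended universe \<open>'h\<close>, subject to the transfer principle for the first-order
  language that has a symbol for every standard relation. Every extension of a full superstructure
  restricts to one of this kind, with the same hypernaturals, internal sets of hypernaturals and
  hyperreals.
\<close>

datatype std = SNat nat | SSet "nat set" | SReal real

datatype fm =
    Rel "std list set" "nat list"
  | Eq nat nat
  | Neg fm
  | And fm fm
  | Ex nat fm

primrec sat :: "(std list set \<Rightarrow> 'a list set) \<Rightarrow> fm \<Rightarrow> (nat \<Rightarrow> 'a) \<Rightarrow> bool" where
  "sat I (Rel A vs) e \<longleftrightarrow> map e vs \<in> I A"
| "sat I (Eq i j) e \<longleftrightarrow> e i = e j"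
| "sat I (Neg p) e \<longleftrightarrow> \<not> sat I p e"
| "sat I (And p q) e \<longleftrightarrow> sat I p e \<and> sat I q e"
| "sat I (Ex i p) e \<longleftrightarrow> (\<exists>x. sat I p (e(i := x)))"

text \<open>Internal sets are the sets definable from internal parameters, i.e. the fibres of
  extensions of standard relations.\<close>

definition internal :: "(std list set \<Rightarrow> 'h list set) \<Rightarrow> 'h set \<Rightarrow> bool" where
  "internal star S \<longleftrightarrow> (\<exists>A p. S = {x. x # p \<in> star A})"

locale nonstd =
  fixes star :: "std list set \<Rightarrow> 'h list set"
  assumes transfer: "(\<forall>e. sat (\<lambda>A. A) p e) \<longleftrightarrow> (\<forall>e. sat star p e)"
    and countable_saturation:
      "\<lbrakk>\<And>n::nat. internal star (S n); \<And>n. (\<Inter>i\<le>n. S i) \<noteq> {}\<rbrakk> \<Longrightarrow> (\<Inter>i. S i) \<noteq> {}"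
begin

definition emb :: "std \<Rightarrow> 'h" where
  "emb u = (THE x. [x] \<in> star {[u]})"

text \<open>The value at \<open>xs\<close> of the extension of the standard function with graph \<open>G\<close>.\<close>

definition app :: "std list set \<Rightarrow> 'h list \<Rightarrow> 'h" where
  "app G xs = (THE y. xs @ [y] \<in> star G)"

text \<open>The natural numbers start at 1, so that cuts inside \<open>[1, N]\<close> are initial segments.\<close>

definition hnat :: "'h set" where
  "hnat = {a. [a] \<in> star {[SNat n] | n. 1 \<le> n}}"

definition hle :: "'h \<Rightarrow> 'h \<Rightarrow> bool" where
  "hle a b \<longleftrightarrow> [a, b] \<in> star {[SNat m, SNat n] | m n. m \<le> n}"

definition hless :: "'h \<Rightarrow> 'h \<Rightarrow> bool" where
  "hless a b \<longleftrightarrow> hle a b \<and> a \<noteq> b"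

definition htimes :: "'h \<Rightarrow> 'h \<Rightarrow> 'h" where
  "htimes a b = app {[SNat m, SNat n, SNat (m * n)] | m n. True} [a, b]"

definition hdiv :: "'h \<Rightarrow> 'h \<Rightarrow> 'h" where
  "hdiv a b = app {[SNat m, SNat n, SNat (m div n)] | m n. True} [a, b]"

definition hinfinite :: "'h \<Rightarrow> bool" where
  "hinfinite a \<longleftrightarrow> a \<in> hnat \<and> (\<forall>n. hless (emb (SNat n)) a)"

definition hseg :: "'h \<Rightarrow> 'h \<Rightarrow> 'h set" where
  "hseg a b = {x \<in> hnat. hle a x \<and> hle x b}"

definition st :: "'h \<Rightarrow> real" where
  "st y = (THE r. \<forall>\<epsilon>>0. [y] \<in> star {[SReal x] | x. \<bar>x - r\<bar> < \<epsilon>})"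

text \<open>The element of the extension of the power set of the naturals that represents an internal
  set of hypernaturals.\<close>

definition hcode :: "'h set \<Rightarrow> 'h" where
  "hcode C = (THE c. [c] \<in> star {[SSet S] | S. True} \<and>
                     C = {x. [x, c] \<in> star {[SNat n, SSet S] | n S. n \<in> S}})"

text \<open>The hyperfinite sum of \<open>1 / (a ln M)\<close> over \<open>a \<in> C\<close>.\<close>

definition hlogsum :: "'h set \<Rightarrow> 'h \<Rightarrow> 'h" where
  "hlogsum C M =
     app {[SSet S, SNat m, SReal (\<Sum>a\<in>S. 1 / (real a * ln (real m)))] | S m. finite S}
         [hcode C, M]"

definition loeb :: "'h \<Rightarrow> 'h \<Rightarrow> 'h measure" where
  "loeb k M = completion (extend_measure (hseg k (htimes M k))
     {C. internal star C \<and> C \<subseteq> hseg k (htimes M k)} (\<lambda>C. C) (\<lambda>C. ennreal (st (hlogsum C M))))"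

definition mult_cut :: "'h set \<Rightarrow> bool" where
  "mult_cut V \<longleftrightarrow> V \<subseteq> hnat \<and> infinite V \<and>
     (\<forall>a\<in>V. \<forall>b\<in>hnat. hle b a \<longrightarrow> b \<in> V) \<and> (\<forall>a\<in>V. \<forall>b\<in>V. htimes a b \<in> V)"

definition veq :: "'h set \<Rightarrow> 'h \<Rightarrow> 'h \<Rightarrow> bool" where
  "veq V a b \<longleftrightarrow> (hle a b \<and> hdiv b a \<in> V) \<or> (hle b a \<and> hdiv a b \<in> V)"

definition cls :: "'h set \<Rightarrow> 'h \<Rightarrow> 'h set" where
  "cls V a = {b \<in> hnat. veq V a b}"

definition vtimes :: "'h set \<Rightarrow> 'h set \<Rightarrow> 'h set \<Rightarrow> 'h set" where
  "vtimes V c d = (\<Union>a\<in>c. \<Union>b\<in>d. cls V (htimes a b))"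

definition vless :: "'h set \<Rightarrow> 'h set \<Rightarrow> 'h set \<Rightarrow> bool" where
  "vless V c d \<longleftrightarrow> (\<exists>a\<in>c. \<exists>b\<in>d. hless a b \<and> \<not> veq V a b)"

definition vle :: "'h set \<Rightarrow> 'h set \<Rightarrow> 'h set \<Rightarrow> bool" where
  "vle V c d \<longleftrightarrow> vless V c d \<or> c = d"

definition vseg :: "'h set \<Rightarrow> 'h set \<Rightarrow> 'h set \<Rightarrow> 'h set set" where
  "vseg V c d = {e \<in> cls V ` hnat. vle V c e \<and> vle V e d}"

definition cls_measure :: "'h \<Rightarrow> 'h \<Rightarrow> 'h set \<Rightarrow> 'h set measure" where
  "cls_measure k M V = measure_of (cls V ` hseg k (htimes M k))
     {E. E \<subseteq> cls V ` hseg k (htimes M k) \<and>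
         cls V -` E \<inter> hseg k (htimes M k) \<in> sets (loeb k M)}
     (\<lambda>E. emeasure (loeb k M) (cls V -` E \<inter> hseg k (htimes M k)))"

text \<open>The measures of \<open>X\<close> in the intervals from \<open>x\<close> to \<open>[r] x\<close> and from \<open>[r]\<inverse> x\<close> to \<open>x\<close>,
  for an arbitrarily chosen representative \<open>b\<close> of \<open>x\<close>. The class \<open>[r]\<inverse> x\<close> is that of the
  integer quotient of \<open>b\<close> by \<open>r\<close>.\<close>

definition right_measure :: "'h set \<Rightarrow> 'h set \<Rightarrow> 'h \<Rightarrow> 'h set set \<Rightarrow> ennreal" where
  "right_measure V x r X =
     (let b = (SOME b. b \<in> x)
      in emeasure (cls_measure b r V) (X \<inter> vseg V x (vtimes V (cls V r) x)))"

definition left_measure :: "'h set \<Rightarrow> 'h set \<Rightarrow> 'h \<Rightarrow> 'h set set \<Rightarrow> ennreal" where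
  "left_measure V x r X =
     (let b = (SOME b. b \<in> x); b' = hdiv b r
      in emeasure (cls_measure b' r V) (X \<inter> vseg V (cls V b') x))"

definition right_density :: "'h set \<Rightarrow> 'h set \<Rightarrow> 'h set set \<Rightarrow> ennreal" where
  "right_density V x X =
     (SUP s\<in>hnat - V. INF r\<in>{r \<in> hnat - V. hless r s}. right_measure V x r X)"

definition left_density :: "'h set \<Rightarrow> 'h set \<Rightarrow> 'h set set \<Rightarrow> ennreal" where
  "left_density V x X =
     (SUP s\<in>hnat - V. INF r\<in>{r \<in> hnat - V. hless r s}. left_measure V x r X)"

definition density_point :: "'h set \<Rightarrow> 'h set set \<Rightarrow> 'h set \<Rightarrow> bool" where
  "density_point V X x \<longleftrightarrow> right_density V x X = 1 \<and> left_density V x X = 1"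

end

end

theory Submission
  imports Defs
begin

text \<open>
  In logarithmic scale \<open>X\<close> is the neighbourhood of the internal set \<open>A\<close> of radius \<open>V\<close>. It lies between
  the internal neighbourhoods of radius \<open>v\<close> in \<open>V\<close> and \<open>s\<close> above \<open>V\<close>, and by overspill these can be
  chosen with measures differing by at most \<open>\<epsilon>\<close>. If \<open>X\<close> has density below \<open>1 - \<eta>\<close> in arbitrarily short
  intervals next to \<open>y\<close>, then one of these intervals lies in the larger neighbourhood and misses
  a proportion \<open>\<eta>\<close> of the smaller one. So \<open>y\<close> lies in the internal set where the maximal function of
  the gap between the two is at least a multiple of \<open>\<eta>\<close>, and by the transferred finite maximal
  inequality this set has measure \<open>O(\<epsilon> / \<eta>)\<close>. The class of \<open>1\<close>, which has no left neighbourhoods,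
  is null because \<open>V\<close> is closed under powers.
\<close>

section \<open>Finite harmonic sums\<close>

text \<open>The infima in the density run over all \<open>r\<close> above \<open>V\<close>, so the
  exceptional set has no evident measurability. It is never measured directly: it is enclosed in
  internal sets of small measure, and completeness of the Loeb measure does the rest. Radii are
  squared in that estimate. A sparse interval next to \<open>y\<close> has a ratio \<open>r\<close>
  below \<open>s\<close>, and passing from it to \<open>y\<close> and on to a point of
  \<open>A\<close> costs further factors from \<open>V\<close>; the whole interval is therefore
  within ratio \<open>s * s\<close> of one point of \<open>A\<close>, though perhaps not within
  \<open>s\<close>. The inner radius \<open>v * v\<close> still belongs to \<open>V\<close>.
  Transfer is packaged so that internal notions need no formulas of their own. Every element of the
  extension is read as a function of a random assignment \<open>d\<close> of standard values, and a
  relation holds in the extension iff it holds eventually along one filter. Internal subsets of an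
  interval become random finite sets of naturals, and the finite inequalities are applied to them
  for each \<open>d\<close> separately.\<close>

definition hsum :: "nat set \<Rightarrow> real" where
  "hsum S = (\<Sum>a\<in>S. 1 / real a)"

lemma hsum_nonneg: "0 \<le> hsum S"
  unfolding hsum_def by (rule sum_nonneg) simp

lemma hsum_mono: "finite T \<Longrightarrow> S \<subseteq> T \<Longrightarrow> hsum S \<le> hsum T"
  unfolding hsum_def by (rule sum_mono2) auto

lemma hsum_Un_disjoint: "finite S \<Longrightarrow> finite T \<Longrightarrow> S \<inter> T = {} \<Longrightarrow> hsum (S \<union> T) = hsum S + hsum T"
  unfolding hsum_def by (rule sum.union_disjoint)

lemma hsum_Un_le: "finite S \<Longrightarrow> finite T \<Longrightarrow> hsum (S \<union> T) \<le> hsum S + hsum T"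
  using hsum_Un_disjoint[of S "T - S"] hsum_mono[of T "T - S"] by (simp add: Diff_subset)

lemma hsum_Diff: "finite T \<Longrightarrow> S \<subseteq> T \<Longrightarrow> hsum (T - S) = hsum T - hsum S"
  unfolding hsum_def by (rule sum_diff)

lemma hsum_interval_lower:
  assumes "1 \<le> l"
  shows "ln (real (l + m) / real l) \<le> hsum {l..<l + m}"
proof (induction m)
  case 0
  then show ?case using assms by (simp add: hsum_def)
next
  case (Suc m)
  define n where "n = l + m"
  have n: "0 < real n" "0 < real l" using assms by (auto simp: n_def)
  have "ln (real (Suc n) / real l) = ln (real n / real l) + ln (1 + 1 / real n)"
  proof -
    have "real (Suc n) / real l = (real n / real l) * (1 + 1 / real n)"
      using n by (simp add: field_simps)
    then show ?thesis using n by (simp only:) (subst ln_mult, auto simp: add_pos_pos)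
  qed
  also have "\<dots> \<le> hsum {l..<n} + 1 / real n"
    using Suc ln_add_one_self_le_self[of "1 / real n"] by (intro add_mono) (auto simp: n_def)
  also have "\<dots> = hsum {l..<Suc n}"
    using assms by (simp add: hsum_def n_def)
  finally show ?case by (simp add: n_def)
qed

text \<open>The additive \<open>1\<close> pays for the first term \<open>1 / real l\<close>; the
  later terms are bounded by increments of \<open>ln\<close>. Divided by the logarithm of an
  infinite number it vanishes in the standard part.\<close>

lemma hsum_interval_upper:
  assumes "1 \<le> l" "l \<le> u"
  shows "hsum {l..u} \<le> 1 + ln (real u / real l)"
  using assms(2)
proof (induction u rule: dec_induct)
  case base
  then show ?case using assms by (simp add: hsum_def)
next
  case (step n)
  have n: "0 < real n" "0 < real l" using assms step by auto
  have "hsum {l..Suc n} = hsum {l..n} + 1 / real (Suc n)"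
    using step assms by (simp add: hsum_def atLeastAtMostSuc_conv)
  also have "\<dots> \<le> 1 + ln (real n / real l) + 1 / real (Suc n)" using step by simp
  also have "1 / real (Suc n) \<le> ln (real (Suc n) / real n)"
  proof -
    have "ln (real n / real (Suc n)) \<le> real n / real (Suc n) - 1"
      using n by (intro ln_le_minus_one) auto
    also have "\<dots> = - (1 / real (Suc n))" by (simp add: field_simps)
    finally show ?thesis using n by (simp add: ln_div)
  qed
  finally show ?case using n by (simp add: ln_div)
qed

lemma ln_le_hsum: "1 \<le> b \<Longrightarrow> 1 \<le> r \<Longrightarrow> ln (real r) \<le> hsum {b..r * b}"
proof -
  assume *: "1 \<le> b" "1 \<le> r"
  have "b \<le> r * b" using * by simp
  then have "r * b = b + (r * b - b)" by simp
  then have "ln (real (r * b) / real b) \<le> hsum {b..<r * b}"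
    using hsum_interval_lower[OF *(1), of "r * b - b"] by simp
  also have "\<dots> \<le> hsum {b..r * b}" by (intro hsum_mono) auto
  finally show ?thesis using * by simp
qed

lemma hsum_le_ln: "1 \<le> b \<Longrightarrow> 1 \<le> r \<Longrightarrow> hsum {b..r * b} \<le> 1 + ln (real r)"
  using hsum_interval_upper[of b "r * b"] by simp

lemma one_le_ln: "3 \<le> r \<Longrightarrow> 1 \<le> ln (real r)"
  using exp_le by (subst ln_ge_iff) auto

lemma ln_of_nat_nonneg: "0 \<le> ln (real n)"
  by (cases "n = 0") auto

text \<open>Greedy covering from the left, as in the rising sun lemma: the interval at the least
  point of \<open>B\<close> swallows all of \<open>B\<close> up to its right end \<open>u\<close>,
  and the induction continues with \<open>B\<close> and \<open>G\<close> both restricted to what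
  lies beyond \<open>u\<close>. The intervals used are disjoint, so no constant is lost.\<close>

lemma hsum_cover_right:
  assumes "finite B" "finite G" "0 \<le> \<eta>"
    and "\<And>y. y \<in> B \<Longrightarrow> \<exists>u\<ge>y. \<eta> * hsum {y..u} \<le> hsum (G \<inter> {y..u})"
  shows "\<eta> * hsum B \<le> hsum G"
  using assms(1,2,4)
proof (induction B arbitrary: G rule: finite_psubset_induct)
  case (psubset B)
  show ?case
  proof (cases "B = {}")
    case True
    then show ?thesis using hsum_nonneg by (simp add: hsum_def)
  next
    case False
    define y where "y = Min B"
    have y: "y \<in> B" "\<And>z. z \<in> B \<Longrightarrow> y \<le> z" unfolding y_def using psubset.hyps False by simp_all
    obtain u where u: "y \<le> u" "\<eta> * hsum {y..u} \<le> hsum (G \<inter> {y..u})" using psubset.prems(2)[OF y(1)] by (elim exE conjE)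
    have IH: "\<eta> * hsum (B \<inter> {u<..}) \<le> hsum (G \<inter> {u<..})"
    proof (rule psubset.IH[of "B \<inter> {u<..}" "G \<inter> {u<..}"])
      show "B \<inter> {u<..} \<subset> B" using y(1) u(1) by (metis Int_iff Int_lower1 greaterThan_iff lessThan_iff not_less psubsetI)
      fix z assume z: "z \<in> B \<inter> {u<..}"
      then obtain w where w: "z \<le> w" "\<eta> * hsum {z..w} \<le> hsum (G \<inter> {z..w})" using psubset.prems(2)[of z] by auto
      \<comment> \<open>An interval that starts beyond \<open>u\<close> meets the same part of
        \<open>G\<close> after the restriction, so the hypothesis survives.\<close>
      have "G \<inter> {u<..} \<inter> {z..w} = G \<inter> {z..w}" using z by auto
      then show "\<exists>w\<ge>z. \<eta> * hsum {z..w} \<le> hsum (G \<inter> {u<..} \<inter> {z..w})" using w by auto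
    next
      show "finite (G \<inter> {u<..})" using psubset.prems(1) by simp
    qed
    have "hsum B \<le> hsum ({y..u} \<union> (B \<inter> {u<..}))"
      using psubset.hyps y(2) by (intro hsum_mono) (auto simp: not_less)
    also have "\<dots> \<le> hsum {y..u} + hsum (B \<inter> {u<..})"
      using psubset(1) by (intro hsum_Un_le) auto
    finally have "\<eta> * hsum B \<le> \<eta> * hsum {y..u} + \<eta> * hsum (B \<inter> {u<..})"
      using assms(3) by (metis distrib_left mult_left_mono)
    also have "\<dots> \<le> hsum (G \<inter> {y..u}) + hsum (G \<inter> {u<..})" using u IH by simp
    also have "\<dots> = hsum (G \<inter> {y..u} \<union> (G \<inter> {u<..}))"
      using psubset.hyps psubset.prems(1) by (intro hsum_Un_disjoint[symmetric]) auto
    also have "\<dots> \<le> hsum G" using psubset.hyps psubset.prems(1) by (intro hsum_mono) auto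
    finally show ?thesis .
  qed
qed

lemma hsum_cover_left:
  assumes "finite B" "finite G" "0 \<le> \<eta>"
    and "\<And>y. y \<in> B \<Longrightarrow> \<exists>u\<le>y. \<eta> * hsum {u..y} \<le> hsum (G \<inter> {u..y})"
  shows "\<eta> * hsum B \<le> hsum G"
  using assms(1,2,4)
proof (induction B arbitrary: G rule: finite_psubset_induct)
  case (psubset B)
  show ?case
  proof (cases "B = {}")
    case True
    then show ?thesis using hsum_nonneg by (simp add: hsum_def)
  next
    case False
    define y where "y = Max B"
    have y: "y \<in> B" "\<And>z. z \<in> B \<Longrightarrow> z \<le> y" unfolding y_def using psubset.hyps False by simp_all
    obtain u where u: "u \<le> y" "\<eta> * hsum {u..y} \<le> hsum (G \<inter> {u..y})" using psubset.prems(2)[OF y(1)] by (elim exE conjE)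
    have IH: "\<eta> * hsum (B \<inter> {..<u}) \<le> hsum (G \<inter> {..<u})"
    proof (rule psubset.IH[of "B \<inter> {..<u}" "G \<inter> {..<u}"])
      show "B \<inter> {..<u} \<subset> B" using y(1) u(1) by (metis Int_iff Int_lower1 greaterThan_iff lessThan_iff not_less psubsetI)
      fix z assume z: "z \<in> B \<inter> {..<u}"
      then obtain w where w: "w \<le> z" "\<eta> * hsum {w..z} \<le> hsum (G \<inter> {w..z})" using psubset.prems(2)[of z] by auto
      have "G \<inter> {..<u} \<inter> {w..z} = G \<inter> {w..z}" using z by auto
      then show "\<exists>w\<le>z. \<eta> * hsum {w..z} \<le> hsum (G \<inter> {..<u} \<inter> {w..z})" using w by auto
    next
      show "finite (G \<inter> {..<u})" using psubset.prems(1) by simp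
    qed
    have "hsum B \<le> hsum ({u..y} \<union> (B \<inter> {..<u}))"
      using psubset.hyps y(2) by (intro hsum_mono) (auto simp: not_less)
    also have "\<dots> \<le> hsum {u..y} + hsum (B \<inter> {..<u})"
      using psubset(1) by (intro hsum_Un_le) auto
    finally have "\<eta> * hsum B \<le> \<eta> * hsum {u..y} + \<eta> * hsum (B \<inter> {..<u})"
      using assms(3) by (metis distrib_left mult_left_mono)
    also have "\<dots> \<le> hsum (G \<inter> {u..y}) + hsum (G \<inter> {..<u})" using u IH by simp
    also have "\<dots> = hsum (G \<inter> {u..y} \<union> (G \<inter> {..<u}))"
      using psubset.hyps psubset.prems(1) by (intro hsum_Un_disjoint[symmetric]) auto
    also have "\<dots> \<le> hsum G" using psubset.hyps psubset.prems(1) by (intro hsum_mono) auto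
    finally show ?thesis .
  qed
qed

text \<open>The weak-type maximal inequality for the indicator of \<open>G\<close>. An interval
  around \<open>y\<close> is cut at \<open>y\<close>; since each half has at most the sum of the
  whole, one of the halves keeps the proportion \<open>\<eta> / 2\<close>. The factor 4 is this 2
  times the two one-sided coverings.\<close>

lemma hsum_maximal_inequality:
  assumes "finite B" "finite G" "0 \<le> \<eta>"
    and "\<And>y. y \<in> B \<Longrightarrow> \<exists>l\<le>y. \<exists>u\<ge>y. \<eta> * hsum {l..u} \<le> hsum (G \<inter> {l..u})"
  shows "\<eta> * hsum B \<le> 4 * hsum G"
proof -
  define R where "R = {y\<in>B. \<exists>u\<ge>y. \<eta> / 2 * hsum {y..u} \<le> hsum (G \<inter> {y..u})}"
  define L where "L = {y\<in>B. \<exists>l\<le>y. \<eta> / 2 * hsum {l..y} \<le> hsum (G \<inter> {l..y})}"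
  have "B \<subseteq> R \<union> L"
  proof
    fix y assume y: "y \<in> B"
    then obtain l u where lu: "l \<le> y" "y \<le> u" "\<eta> * hsum {l..u} \<le> hsum (G \<inter> {l..u})"
      using assms(4) by blast
    have "hsum (G \<inter> {l..u}) \<le> hsum (G \<inter> {l..y} \<union> G \<inter> {y..u})"
      using assms by (intro hsum_mono) auto
    also have "\<dots> \<le> hsum (G \<inter> {l..y}) + hsum (G \<inter> {y..u})"
      using assms by (intro hsum_Un_le) auto
    finally have 1: "hsum (G \<inter> {l..u}) \<le> hsum (G \<inter> {l..y}) + hsum (G \<inter> {y..u})" .
    have "\<eta> / 2 * hsum {l..y} \<le> \<eta> / 2 * hsum {l..u}" "\<eta> / 2 * hsum {y..u} \<le> \<eta> / 2 * hsum {l..u}"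
      using lu assms(3) by (auto intro!: mult_left_mono hsum_mono)
    then have "\<eta> / 2 * hsum {l..y} + \<eta> / 2 * hsum {y..u} \<le> hsum (G \<inter> {l..y}) + hsum (G \<inter> {y..u})"
      using 1 lu(3) by linarith
    then have "\<eta> / 2 * hsum {l..y} \<le> hsum (G \<inter> {l..y}) \<or> \<eta> / 2 * hsum {y..u} \<le> hsum (G \<inter> {y..u})"
      by linarith
    then show "y \<in> R \<union> L" using lu y by (auto simp: R_def L_def)
  qed
  then have "hsum B \<le> hsum R + hsum L"
    using hsum_mono[of "R \<union> L" B] hsum_Un_le[of R L] assms(1) by (fastforce simp: R_def L_def)
  then have "\<eta> / 2 * hsum B \<le> \<eta> / 2 * hsum R + \<eta> / 2 * hsum L"
    using assms(3) mult_left_mono[of "hsum B" "hsum R + hsum L" "\<eta> / 2"] by (simp add: distrib_left)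
  moreover have "\<eta> / 2 * hsum R \<le> hsum G"
    using assms by (intro hsum_cover_right) (auto simp: R_def)
  moreover have "\<eta> / 2 * hsum L \<le> hsum G"
    using assms by (intro hsum_cover_left) (auto simp: L_def)
  ultimately show ?thesis by linarith
qed

section \<open>Neighbourhoods of radius \<open>ln n\<close> in logarithmic scale\<close>

definition nbhd :: "nat set \<Rightarrow> nat \<Rightarrow> nat set" where
  "nbhd A n = {c. 1 \<le> c \<and> (\<exists>a\<in>A. c \<le> n * a \<and> a \<le> n * c)}"

lemma nbhd_mono: "n \<le> m \<Longrightarrow> nbhd A n \<subseteq> nbhd A m"
  unfolding nbhd_def by (blast intro: order_trans mult_le_mono1)

lemma finite_nbhd: "finite A \<Longrightarrow> finite (nbhd A n)"
proof -
  assume "finite A"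
  then have "finite (\<Union>a\<in>A. {..n * a})" by simp
  then show ?thesis by (rule rev_finite_subset) (auto simp: nbhd_def)
qed

text \<open>Serves to keep the normalised sums bounded by a standard constant, as
  \<open>cut_gap\<close> demands. The extreme points of the neighbourhood have ratio at most
  \<open>N ^ 5\<close>: a factor \<open>n * n \<le> N * N\<close> at either end to reach
  \<open>A\<close>, and \<open>N\<close> for the interval that contains \<open>A\<close>. The sixth
  \<open>ln (real N)\<close> absorbs the additive \<open>1\<close>.\<close>

lemma hsum_nbhd_le:
  assumes "A \<subseteq> {k..N * k}" "1 \<le> k" "1 \<le> n" "n \<le> N" "3 \<le> N"
  shows "hsum (nbhd A (n * n)) \<le> 6 * ln (real N)"
proof (cases "nbhd A (n * n) = {}")
  case True
  then show ?thesis using assms by (simp add: hsum_def)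
next
  case False
  let ?S = "nbhd A (n * n)"
  have fin: "finite ?S" using assms(1) finite_nbhd finite_subset by blast
  define l u where "l = Min ?S" and "u = Max ?S"
  have lu: "l \<in> ?S" "u \<in> ?S" "?S \<subseteq> {l..u}" "l \<le> u"
    using fin False by (auto simp: l_def u_def)
  obtain a where a: "1 \<le> l" "a \<in> A" "a \<le> n * n * l" using lu(1) unfolding nbhd_def by blast
  then have l: "1 \<le> l" "k \<le> n * n * l" using assms(1) by fastforce+
  obtain a' where a': "a' \<in> A" "u \<le> n * n * a'" using lu(2) unfolding nbhd_def by blast
  have "u \<le> n * n * a'" by fact
  also have "\<dots> \<le> n * n * (N * k)" using a'(1) assms(1) by (intro mult_le_mono2) auto
  also have "\<dots> \<le> n * n * (N * (n * n * l))" using l by simp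
  also have "\<dots> \<le> N * N * (N * (N * N * l))" using assms(4) by (intro mult_le_mono) auto
  also have "\<dots> = N ^ 5 * l" by (simp add: numeral_eq_Suc)
  finally have u: "real u \<le> real N ^ 5 * real l"
    by (metis of_nat_le_iff of_nat_mult of_nat_power)
  have "hsum ?S \<le> 1 + ln (real u / real l)"
    using hsum_mono[OF _ lu(3)] hsum_interval_upper[OF l(1) lu(4)] by simp
  also have "ln (real u / real l) \<le> ln (real N ^ 5)"
    using u l lu by (intro ln_mono) (auto simp: field_simps)
  also have "ln (real N ^ 5) = 5 * ln (real N)" using assms by (simp add: ln_realpow)
  finally show ?thesis using one_le_ln[OF assms(5)] by simp
qed

text \<open>Every point from \<open>b\<close> to \<open>r * b\<close> is within ratio
  \<open>u * r \<le> s * s\<close> of the single point \<open>a\<close>, so whatever the interval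
  misses of the inner neighbourhood belongs to the gap: at least
  \<open>\<eta> * ln (real r)\<close>. The interval need not contain \<open>y\<close>, but the hull
  of both has ratio at most \<open>u * r * u \<le> r ^ 3\<close>. Its sum is at most
  \<open>1 + 3 * ln (real r)\<close>, hence at most \<open>4 * ln (real r)\<close>, which turns
  \<open>\<eta>\<close> into \<open>\<eta> / 4\<close>.\<close>

lemma gap_interval:
  assumes "finite A" "a \<in> A" "1 \<le> b" "1 \<le> y" "1 \<le> u" "u \<le> r" "r \<le> s" "3 \<le> r" "0 \<le> \<eta>"
    and "b \<le> u * a" "a \<le> u * r * b" "b \<le> u * y" "y \<le> u * r * b"
    and small: "hsum (nbhd A (v * v) \<inter> {b..r * b}) \<le> (1 - \<eta>) * ln (real r)"
  shows "\<exists>l\<le>y. \<exists>w\<ge>y. \<eta> / 4 * hsum {l..w} \<le> hsum ((nbhd A (s * s) - nbhd A (v * v)) \<inter> {l..w})"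
proof -
  let ?G = "nbhd A (s * s) - nbhd A (v * v)"
  have ur: "u * r \<le> s * s" using assms by (intro mult_le_mono) auto
  have sub: "{b..r * b} \<subseteq> nbhd A (s * s)"
  proof
    fix c assume c: "c \<in> {b..r * b}"
    have "c \<le> r * (u * a)" using c assms(10) by (meson atLeastAtMost_iff le_trans mult_le_mono2)
    also have "\<dots> \<le> s * s * a" using ur by (metis mult.assoc mult.commute mult_le_mono1)
    finally have "c \<le> s * s * a" .
    moreover have "a \<le> s * s * c"
      using assms(11) mult_le_mono[OF ur, of b c] c by simp
    ultimately show "c \<in> nbhd A (s * s)" using c assms unfolding nbhd_def by auto
  qed
  have "ln (real r) \<le> hsum {b..r * b}" using assms by (intro ln_le_hsum) auto
  also have "\<dots> = hsum (nbhd A (v * v) \<inter> {b..r * b} \<union> (?G \<inter> {b..r * b}))"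
    using sub by (intro arg_cong[of _ _ hsum]) auto
  also have "\<dots> \<le> hsum (nbhd A (v * v) \<inter> {b..r * b}) + hsum (?G \<inter> {b..r * b})"
    by (intro hsum_Un_le) auto
  finally have 1: "\<eta> * ln (real r) \<le> hsum (?G \<inter> {b..r * b})"
    using small by (simp add: algebra_simps)
  define l where "l = min b y"
  define w where "w = max (r * b) y"
  have w: "w \<le> u * r * b" unfolding w_def using assms by simp
  have l: "1 \<le> l" "b \<le> u * l" unfolding l_def using assms by (auto simp: min_def)
  have lw: "l \<le> w" unfolding l_def w_def by auto
  have "w \<le> u * r * (u * l)" using w l by (meson le_trans mult_le_mono2)
  also have "\<dots> \<le> r * r * (r * l)" using assms by (intro mult_le_mono) auto
  also have "\<dots> = r ^ 3 * l" by (simp add: numeral_eq_Suc)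
  finally have "real w \<le> real r ^ 3 * real l" by (metis of_nat_le_iff of_nat_mult of_nat_power)
  then have "ln (real w / real l) \<le> ln (real r ^ 3)"
    using l lw by (intro ln_mono) (auto simp: field_simps)
  also have "\<dots> = 3 * ln (real r)" using assms by (simp add: ln_realpow)
  finally have "hsum {l..w} \<le> 4 * ln (real r)"
    using hsum_interval_upper[OF l(1) lw] one_le_ln[OF assms(8)] by simp
  then have "\<eta> / 4 * hsum {l..w} \<le> \<eta> * ln (real r)"
    using mult_left_mono[of "hsum {l..w}" "4 * ln (real r)" "\<eta> / 4"] assms(9) by simp
  also have "\<dots> \<le> hsum (?G \<inter> {l..w})"
    using 1 by (rule order_trans) (intro hsum_mono, auto simp: l_def w_def)
  finally show ?thesis by (intro exI[of _ l] conjI exI[of _ w]) (auto simp: l_def w_def)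
qed

section \<open>Transfer along a filter\<close>

text \<open>The relations \<open>star A\<close> speak about finite tuples, so the filter
  \<open>gen\<close> defined below decides only properties of finitely many values. A finitary
  function of the assignment stands for an object defined from finitely many internal
  parameters.\<close>

definition finitary :: "(('h \<Rightarrow> std) \<Rightarrow> 'b) \<Rightarrow> bool" where
  "finitary f \<longleftrightarrow> (\<exists>S. finite S \<and> (\<forall>d d'. (\<forall>a\<in>S. d a = d' a) \<longrightarrow> f d = f d'))"

lemma finitaryI:
  assumes "finite S" "\<And>d d'. (\<forall>a\<in>S. d a = d' a) \<Longrightarrow> f d = f d'"
  shows "finitary f"
  using assms unfolding finitary_def by blast

text \<open>Brings the dependence into the form that \<open>star\<close> accepts, a standard
  relation on a list of parameters. The assignment chosen inside \<open>g\<close> is immaterial,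
  because any two with the same values on \<open>p\<close> agree on \<open>S\<close>.\<close>

lemma finitary_list:
  assumes "finitary f"
  obtains p g where "\<And>d. f d = g (map d p)"
proof -
  obtain S where S: "finite S" "\<And>d d'. (\<forall>a\<in>S. d a = d' a) \<Longrightarrow> f d = f d'"
    using assms unfolding finitary_def by blast
  obtain p where p: "set p = S" using S(1) finite_list by blast
  define g where "g xs = f (SOME d. map d p = xs)" for xs
  have "f d = g (map d p)" for d
  proof -
    have "map (SOME d'. map d' p = map d p) p = map d p"
      by (rule someI[of "\<lambda>d'. map d' p = map d p" d]) simp
    then have "\<forall>a\<in>S. (SOME d'. map d' p = map d p) a = d a" using p by auto
    then show ?thesis unfolding g_def by (metis S(2))
  qed
  then show ?thesis using that by blast
qed

lemma finitary_SSet: "finitary f \<Longrightarrow> finitary (\<lambda>d. SSet (f d))"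
  unfolding finitary_def by metis

lemma finitary_comp2:
  fixes f :: "('a \<Rightarrow> std) \<Rightarrow> 'b" and g :: "('a \<Rightarrow> std) \<Rightarrow> 'c"
  assumes "finitary f" "finitary g"
  shows "finitary (\<lambda>d. h (f d) (g d))"
proof -
  obtain S T where S: "finite S" "\<And>d d'. (\<forall>a\<in>S. d a = d' a) \<Longrightarrow> f d = f d'"
    and T: "finite T" "\<And>d d'. (\<forall>a\<in>T. d a = d' a) \<Longrightarrow> g d = g d'"
    using assms unfolding finitary_def by metis
  show ?thesis
  proof (rule finitaryI[of "S \<union> T"])
    fix d d' :: "'a \<Rightarrow> std" assume *: "\<forall>a\<in>S \<union> T. d a = d' a"
    then have "f d = f d'" by (intro S(2)) simp
    moreover have "g d = g d'" using * by (intro T(2)) simp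
    ultimately show "h (f d) (g d) = h (f d') (g d')" by simp
  qed (use S(1) T(1) in simp)
qed

lemma finitary_comp: "finitary f \<Longrightarrow> finitary (\<lambda>d. h (f d))"
  using finitary_comp2[of f f "\<lambda>x y. h x"] by simp

lemma finitary_coord: "finitary (\<lambda>d. d x)"
  by (rule finitaryI[of "{x}"]) simp_all

lemma finitary_comp3:
  "finitary f \<Longrightarrow> finitary g \<Longrightarrow> finitary i \<Longrightarrow> finitary (\<lambda>d. h (f d) (g d) (i d))"
  using finitary_comp2[of "\<lambda>d. h (f d) (g d)" i "\<lambda>p x. p x"] finitary_comp2[of f g h] by simp

primrec nat_part :: "std \<Rightarrow> nat" where
  "nat_part (SNat n) = n" | "nat_part (SSet S) = 0" | "nat_part (SReal x) = 0"

primrec set_part :: "std \<Rightarrow> nat set" where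
  "set_part (SNat n) = {}" | "set_part (SSet S) = S" | "set_part (SReal x) = {}"

primrec real_part :: "std \<Rightarrow> real" where
  "real_part (SNat n) = 0" | "real_part (SSet S) = 0" | "real_part (SReal x) = x"

context nonstd begin

lemma transfer_sat: "(\<And>e. sat (\<lambda>A. A) p e) \<Longrightarrow> sat star p e"
  using transfer[of p] by blast

text \<open>The injection \<open>ix\<close> gives every entry of the three lists a variable, the
  same one for equal entries, so that a standard assignment of the variables induces a
  \<open>d\<close> to which the hypothesis applies. The index \<open>n\<close> lies outside the
  range of \<open>ix\<close> and can be bound by the quantifier.\<close>

lemma star_entails_ex:
  assumes "p \<in> star A" "p' \<in> star A'"
    and "\<And>d. map d p \<in> A \<Longrightarrow> map d p' \<in> A' \<Longrightarrow> \<exists>x. x # map d q \<in> B"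
  shows "\<exists>x. x # q \<in> star B"
proof -
  let ?S = "set (p @ p' @ q)"
  have "finite ?S" by simp
  then obtain ix :: "'h \<Rightarrow> nat" and n where ix: "ix ` ?S = {i. i < n}" "inj_on ix ?S"
    using finite_imp_inj_to_nat_seg by metis
  define e where "e = inv_into ?S ix"
  have e: "map e (map ix r) = r" if "set r \<subseteq> ?S" for r
  proof -
    have "(e \<circ> ix) a = a" if "a \<in> ?S" for a
      unfolding e_def using inv_into_f_f[OF ix(2) that] by simp
    then show ?thesis using that by (simp add: map_idI subset_iff)
  qed
  have n: "n \<notin> set (map ix q)" using ix(1) by auto
  have upd: "map (f(n := x)) (map ix q) = map f (map ix q)" for f :: "nat \<Rightarrow> 'c" and x
    using n by auto
  let ?\<phi> = "Neg (And (And (Rel A (map ix p)) (Rel A' (map ix p'))) (Neg (Ex n (Rel B (n # map ix q)))))"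
  have "sat star ?\<phi> e"
  proof (rule transfer_sat)
    fix f :: "nat \<Rightarrow> std"
    have "(f(n := x)) n # map (f(n := x) \<circ> ix) q = x # map (f \<circ> ix) q" for x
      using upd[of f x] by simp
    then show "sat (\<lambda>A. A) ?\<phi> f"
      using assms(3)[of "f \<circ> ix"] by (simp del: fun_upd_apply list.map_comp map_eq_conv list.inject)
  qed
  moreover have sub: "set p \<subseteq> ?S" "set p' \<subseteq> ?S" "set q \<subseteq> ?S" by auto
  ultimately show ?thesis
    using assms(1,2) e[of p, OF sub(1)] e[of p', OF sub(2)] e[of q, OF sub(3)] upd[of e]
    by (auto simp del: map_map map_eq_conv)
qed

text \<open>A dummy head \<open>x\<close> makes the conclusion existential, which reduces it to
  \<open>star_entails_ex\<close>; a second transferred formula strips the dummy again.\<close>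

lemma star_entails:
  assumes "p \<in> star A" "p' \<in> star A'"
    and "\<And>d. map d p \<in> A \<Longrightarrow> map d p' \<in> A' \<Longrightarrow> map d q \<in> B"
  shows "q \<in> star B"
proof -
  have "\<exists>x. x # q \<in> star {x # xs | x xs. xs \<in> B}"
    by (rule star_entails_ex[OF assms(1,2)]) (use assms(3) in auto)
  then obtain x where x: "x # q \<in> star {x # xs | x xs. xs \<in> B}" by blast
  let ?n = "length q"
  let ?\<phi> = "Neg (And (Rel {x # xs | x xs. xs \<in> B} [0..<Suc ?n]) (Neg (Rel B [1..<Suc ?n])))"
  have "sat star ?\<phi> (\<lambda>i. (x # q) ! i)"
    by (rule transfer_sat) (auto simp: upt_rec[of 0] simp del: upt_Suc)
  moreover have "map ((!) (x # q)) [0..<Suc ?n] = x # q"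
    by (metis length_Cons map_nth)
  moreover have "map ((!) (x # q)) [1..<Suc ?n] = q"
    by (rule nth_equalityI) (simp_all del: upt_Suc)
  ultimately show ?thesis using x by (simp del: upt_Suc)
qed

lemma star_compl: "p \<in> star A \<or> p \<in> star (- A)"
proof -
  let ?v = "[0..<length p]"
  have "sat star (Neg (And (Neg (Rel A ?v)) (Neg (Rel (- A) ?v)))) (\<lambda>i. p ! i)"
    by (rule transfer_sat) auto
  then show ?thesis by (auto simp: map_nth)
qed

lemma star_empty: "p \<notin> star {}"
proof -
  have "sat star (Neg (Rel {} [0..<length p])) (\<lambda>i. p ! i)"
    by (rule transfer_sat) auto
  then show ?thesis by (auto simp: map_nth)
qed

lemma star_eqD: "[x, y] \<in> star {[u, u] | u. True} \<Longrightarrow> x = y"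
proof -
  have "sat star (Neg (And (Rel {[u, u] | u. True} [0, 1]) (Neg (Eq 0 1)))) (\<lambda>i. [x, y] ! i)"
    by (rule transfer_sat) auto
  then show "[x, y] \<in> star {[u, u] | u. True} \<Longrightarrow> x = y" by auto
qed

text \<open>Along this filter on the assignments of standard values to the extended universe, an element
  \<open>a\<close> behaves like the random value \<open>d a\<close>: a tuple lies in \<open>star A\<close> iff its values eventually lie
  in \<open>A\<close>. Transfer makes the filter an ultrafilter for properties of finitely many values.\<close>

definition gen :: "('h \<Rightarrow> std) filter" where
  "gen = (INF (p, A)\<in>{(p, A). p \<in> star A}. principal {d. map d p \<in> A})"

lemma eventually_gen:
  "eventually P gen \<longleftrightarrow> (\<exists>p A. p \<in> star A \<and> (\<forall>d. map d p \<in> A \<longrightarrow> P d))"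
proof -
  let ?B = "{(p, A). p \<in> star A}"
  have ne: "?B \<noteq> {}" using star_compl by blast
  have dir: "\<exists>x\<in>?B. (case x of (p, A) \<Rightarrow> principal {d. map d p \<in> A})
       \<le> inf (case a of (p, A) \<Rightarrow> principal {d. map d p \<in> A})
             (case b of (p, A) \<Rightarrow> principal {d. map d p \<in> A})"
    if mem: "a \<in> ?B" "b \<in> ?B" for a b
  proof -
    obtain p A q B where ab: "a = (p, A)" "b = (q, B)" "p \<in> star A" "q \<in> star B"
      using mem by auto
    \<comment> \<open>The length condition makes the splitting of a concatenated list unique, so
      that membership in \<open>?C\<close> gives back both memberships.\<close>
    let ?C = "{xs @ ys | xs ys. xs \<in> A \<and> ys \<in> B \<and> length xs = length p}"
    have "p @ q \<in> star ?C"
      by (rule star_entails[OF ab(3,4)]) (force simp only: map_append mem_Collect_eq length_map)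
    moreover have "principal {d. map d (p @ q) \<in> ?C}
        \<le> inf (principal {d. map d p \<in> A}) (principal {d. map d q \<in> B})"
      by auto
    ultimately show ?thesis using ab by (intro bexI[of _ "(p @ q, ?C)"]) auto
  qed
  show ?thesis
    unfolding gen_def by (subst eventually_INF_base[OF ne dir]) (auto simp: eventually_principal)
qed

text \<open>The atomic case of Los's theorem. The right-to-left direction is the definition of the
  filter; the other says that the filter contains nothing beyond what transfer already
  forces.\<close>

lemma eventually_star: "(\<forall>\<^sub>F d in gen. map d p \<in> A) \<longleftrightarrow> p \<in> star A"
proof
  assume "\<forall>\<^sub>F d in gen. map d p \<in> A"
  then obtain q B where "q \<in> star B" "\<forall>d. map d q \<in> B \<longrightarrow> map d p \<in> A"
    unfolding eventually_gen by blast
  then show "p \<in> star A" by (blast intro: star_entails[of q B q B])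
next
  assume "p \<in> star A"
  then show "\<forall>\<^sub>F d in gen. map d p \<in> A" unfolding eventually_gen by blast
qed

lemma gen_nontrivial: "\<not> (\<forall>\<^sub>F d in gen. False)"
proof
  assume "\<forall>\<^sub>F d in gen. False"
  then have "\<forall>\<^sub>F d in gen. map d [] \<in> {}" by (rule eventually_mono) simp
  then show False using star_empty[of "[]"] eventually_star[of "[]" "{}"] by blast
qed

lemma gen_const [simp]: "(\<forall>\<^sub>F d in gen. P) \<longleftrightarrow> P"
  using gen_nontrivial by (cases P) simp_all

text \<open>The negation step of Los's theorem: the parameter list of \<open>P\<close> lies in the
  extension of a relation or in that of its complement. Only finitary properties have such a
  list.\<close>

lemma gen_ultra:
  assumes "finitary P"
  shows "(\<forall>\<^sub>F d in gen. \<not> P d) \<longleftrightarrow> \<not> (\<forall>\<^sub>F d in gen. P d)"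
proof -
  obtain p g where g: "\<And>d. P d = g (map d p)" using finitary_list[OF assms] by metis
  have "\<forall>\<^sub>F d in gen. \<not> P d" if "\<not> (\<forall>\<^sub>F d in gen. P d)"
    using that star_compl[of p "{xs. g xs}"] eventually_star[of p "{xs. g xs}"]
      eventually_star[of p "- {xs. g xs}"] by (auto simp: g)
  moreover have False if "\<forall>\<^sub>F d in gen. P d" "\<forall>\<^sub>F d in gen. \<not> P d"
  proof -
    have "\<forall>\<^sub>F d in gen. False" using that by eventually_elim simp
    then show False using gen_nontrivial by blast
  qed
  ultimately show ?thesis by blast
qed

text \<open>The existential step of Los's theorem: witnesses that vary with \<open>d\<close> are the
  values of one element of the extended universe.\<close>

lemma gen_ex:
  assumes "finitary Q" "\<forall>\<^sub>F d in gen. \<exists>x. Q d x"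
  obtains y where "\<forall>\<^sub>F d in gen. Q d (d y)"
proof -
  obtain p g where g: "\<And>d. Q d = g (map d p)" using finitary_list[OF assms(1)] by metis
  have "\<forall>\<^sub>F d in gen. map d p \<in> {xs. \<exists>x. g xs x}" using assms(2) by (simp add: g)
  then have *: "p \<in> star {xs. \<exists>x. g xs x}" by (simp only: eventually_star)
  have "\<exists>x. x # p \<in> star {x # xs | x xs. g xs x}"
    by (rule star_entails_ex[OF * *]) blast
  then obtain y where "y # p \<in> star {x # xs | x xs. g xs x}" by blast
  then have "\<forall>\<^sub>F d in gen. Q d (d y)"
    unfolding eventually_star[symmetric] by eventually_elim (auto simp: g)
  then show ?thesis using that by blast
qed

lemma gen_value:
  assumes "finitary f"
  obtains y where "\<forall>\<^sub>F d in gen. d y = f d"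
proof -
  have "finitary (\<lambda>d x. x = f d)" using assms unfolding finitary_def by metis
  then show ?thesis using gen_ex[of "\<lambda>d x. x = f d"] that by auto
qed

lemma gen_eq: "\<forall>\<^sub>F d in gen. d x = d y \<Longrightarrow> x = y"
proof -
  assume "\<forall>\<^sub>F d in gen. d x = d y"
  then have "\<forall>\<^sub>F d in gen. map d [x, y] \<in> {[u, u] | u. True}" by eventually_elim simp
  then show "x = y" unfolding eventually_star by (rule star_eqD)
qed

lemma internal_gen:
  assumes "finitary Q"
  shows "internal star {x. \<forall>\<^sub>F d in gen. Q d (d x)}"
proof -
  obtain p g where g: "\<And>d. Q d = g (map d p)" using finitary_list[OF assms(1)] by metis
  have "(\<forall>\<^sub>F d in gen. Q d (d x)) \<longleftrightarrow> x # p \<in> star {x # xs | x xs. g xs x}" for x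
    unfolding eventually_star[symmetric] by (simp add: g)
  then show ?thesis unfolding internal_def by blast
qed

lemma internalE:
  assumes "internal star S"
  obtains Q where "finitary Q" "S = {x. \<forall>\<^sub>F d in gen. Q d (d x)}"
proof -
  obtain A p where S: "S = {x. x # p \<in> star A}" using assms unfolding internal_def by blast
  have "finitary (\<lambda>d x. x # map d p \<in> A)" by (rule finitaryI[of "set p"]) (auto cong: map_cong)
  moreover have "S = {x. \<forall>\<^sub>F d in gen. d x # map d p \<in> A}"
    unfolding S eventually_star[symmetric] by simp
  ultimately show ?thesis using that[of "\<lambda>d x. x # map d p \<in> A"] by simp
qed

text \<open>\<open>app\<close> is a definite description, so the graph must eventually be functional
  at these arguments; the second assumption says so and names the value. Uniqueness in the extension
  then follows from \<open>gen_eq\<close>.\<close>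

lemma app_value:
  assumes "finitary f" "\<forall>\<^sub>F d in gen. \<forall>y. map d xs @ [y] \<in> G \<longleftrightarrow> y = f d"
  shows "\<forall>\<^sub>F d in gen. d (app G xs) = f d"
proof -
  obtain y0 where y0: "\<forall>\<^sub>F d in gen. d y0 = f d" using gen_value[OF assms(1)] by blast
  have *: "xs @ [y] \<in> star G \<longleftrightarrow> (\<forall>\<^sub>F d in gen. d y = f d)" for y
  proof -
    have "xs @ [y] \<in> star G \<longleftrightarrow> (\<forall>\<^sub>F d in gen. map d xs @ [d y] \<in> G)"
      using eventually_star[of "xs @ [y]" G] by simp
    also have "\<dots> \<longleftrightarrow> (\<forall>\<^sub>F d in gen. d y = f d)"
      by (rule eventually_subst) (use assms(2) in eventually_elim, simp)
    finally show ?thesis .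
  qed
  have "app G xs = y0"
    unfolding app_def
  proof (rule the_equality)
    show "xs @ [y0] \<in> star G" using * y0 by blast
    fix y assume "xs @ [y] \<in> star G"
    then have "\<forall>\<^sub>F d in gen. d y = f d" using * by blast
    with y0 have "\<forall>\<^sub>F d in gen. d y = d y0" by eventually_elim simp
    then show "y = y0" by (rule gen_eq)
  qed
  then show ?thesis using y0 by simp
qed

lemma emb_value: "\<forall>\<^sub>F d in gen. d (emb u) = u"
proof -
  have "\<forall>\<^sub>F d in gen. d (app {[u]} []) = u"
    by (rule app_value, rule finitaryI[of "{}"]) simp_all
  then show ?thesis by (simp add: app_def emb_def)
qed

end

section \<open>Hypernaturals and cuts\<close>

context nonstd begin

lemma hnat_iff:
  "a \<in> hnat \<longleftrightarrow> (\<forall>\<^sub>F d in gen. d a = SNat (nat_part (d a)) \<and> 1 \<le> nat_part (d a))"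
proof -
  have "a \<in> hnat \<longleftrightarrow> (\<forall>\<^sub>F d in gen. map d [a] \<in> {[SNat n] | n. 1 \<le> n})"
    unfolding eventually_star by (simp add: hnat_def)
  moreover have "map d [a] \<in> {[SNat n] | n. 1 \<le> n} \<longleftrightarrow> d a = SNat (nat_part (d a)) \<and> 1 \<le> nat_part (d a)" for d
    by (cases "d a") auto
  ultimately show ?thesis by simp
qed

lemma hnat_pos: "a \<in> hnat \<Longrightarrow> \<forall>\<^sub>F d in gen. 1 \<le> nat_part (d a)"
  unfolding hnat_iff by (erule eventually_mono) simp

lemma hnat_value: "a \<in> hnat \<Longrightarrow> \<forall>\<^sub>F d in gen. d a = SNat (nat_part (d a))"
  unfolding hnat_iff by (erule eventually_mono) simp

lemma hnatI: "\<forall>\<^sub>F d in gen. d a = SNat (f d) \<Longrightarrow> \<forall>\<^sub>F d in gen. 1 \<le> f d \<Longrightarrow> a \<in> hnat"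
  unfolding hnat_iff by (erule (1) eventually_elim2) simp

lemma hnat_eqI:
  assumes "a \<in> hnat" "b \<in> hnat" "\<forall>\<^sub>F d in gen. nat_part (d a) = nat_part (d b)"
  shows "a = b"
  using hnat_value[OF assms(1)] hnat_value[OF assms(2)] assms(3)
  by (intro gen_eq, eventually_elim) simp

lemma hle_iff:
  assumes "a \<in> hnat" "b \<in> hnat"
  shows "hle a b \<longleftrightarrow> (\<forall>\<^sub>F d in gen. nat_part (d a) \<le> nat_part (d b))"
proof -
  have "hle a b \<longleftrightarrow> (\<forall>\<^sub>F d in gen. map d [a, b] \<in> {[SNat m, SNat n] | m n. m \<le> n})"
    unfolding eventually_star by (simp add: hle_def)
  also have "\<dots> \<longleftrightarrow> (\<forall>\<^sub>F d in gen. nat_part (d a) \<le> nat_part (d b))"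
  proof (rule eventually_subst)
    show "\<forall>\<^sub>F d in gen. map d [a, b] \<in> {[SNat m, SNat n] | m n. m \<le> n} \<longleftrightarrow> nat_part (d a) \<le> nat_part (d b)"
      using hnat_value[OF assms(1)] hnat_value[OF assms(2)]
    proof eventually_elim
      case (elim d)
      then show ?case by (cases "d a"; cases "d b") auto
    qed
  qed
  finally show ?thesis .
qed

lemma not_hle_iff:
  assumes "a \<in> hnat" "b \<in> hnat"
  shows "\<not> hle a b \<longleftrightarrow> (\<forall>\<^sub>F d in gen. nat_part (d b) < nat_part (d a))"
  unfolding hle_iff[OF assms]
  by (subst gen_ultra[symmetric], rule finitaryI[of "{a, b}"]) (simp_all add: not_le)

lemma hless_iff:
  assumes "a \<in> hnat" "b \<in> hnat"
  shows "hless a b \<longleftrightarrow> (\<forall>\<^sub>F d in gen. nat_part (d a) < nat_part (d b))"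
proof
  assume *: "hless a b"
  have "\<not> hle b a"
  proof
    assume "hle b a"
    then have "\<forall>\<^sub>F d in gen. nat_part (d b) \<le> nat_part (d a)" using hle_iff assms by blast
    moreover have "\<forall>\<^sub>F d in gen. nat_part (d a) \<le> nat_part (d b)"
      using * hle_iff assms unfolding hless_def by blast
    ultimately have "\<forall>\<^sub>F d in gen. nat_part (d a) = nat_part (d b)" by eventually_elim simp
    then have "a = b" using hnat_eqI assms by blast
    then show False using * by (simp add: hless_def)
  qed
  then show "\<forall>\<^sub>F d in gen. nat_part (d a) < nat_part (d b)" using not_hle_iff assms by blast
next
  assume *: "\<forall>\<^sub>F d in gen. nat_part (d a) < nat_part (d b)"
  then have "\<forall>\<^sub>F d in gen. nat_part (d a) \<le> nat_part (d b)" by eventually_elim simp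
  moreover have "a \<noteq> b" using * by auto
  ultimately show "hless a b" using hle_iff assms unfolding hless_def by blast
qed

lemma htimes_value:
  assumes "a \<in> hnat" "b \<in> hnat"
  shows "\<forall>\<^sub>F d in gen. d (htimes a b) = SNat (nat_part (d a) * nat_part (d b))"
  unfolding htimes_def
proof (rule app_value)
  show "finitary (\<lambda>d. SNat (nat_part (d a) * nat_part (d b)))"
    by (rule finitaryI[of "{a, b}"]) simp_all
  show "\<forall>\<^sub>F d in gen. \<forall>y. map d [a, b] @ [y] \<in> {[SNat m, SNat n, SNat (m * n)] |m n. True} \<longleftrightarrow>
      y = SNat (nat_part (d a) * nat_part (d b))"
    using hnat_value[OF assms(1)] hnat_value[OF assms(2)]
  proof eventually_elim
    case (elim d)
    then show ?case by (cases "d a"; cases "d b") auto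
  qed
qed

lemma hdiv_value:
  assumes "a \<in> hnat" "b \<in> hnat"
  shows "\<forall>\<^sub>F d in gen. d (hdiv a b) = SNat (nat_part (d a) div nat_part (d b))"
  unfolding hdiv_def
proof (rule app_value)
  show "finitary (\<lambda>d. SNat (nat_part (d a) div nat_part (d b)))"
    by (rule finitaryI[of "{a, b}"]) simp_all
  show "\<forall>\<^sub>F d in gen. \<forall>y. map d [a, b] @ [y] \<in> {[SNat m, SNat n, SNat (m div n)] |m n. True} \<longleftrightarrow>
      y = SNat (nat_part (d a) div nat_part (d b))"
    using hnat_value[OF assms(1)] hnat_value[OF assms(2)]
  proof eventually_elim
    case (elim d)
    then show ?case by (cases "d a"; cases "d b") auto
  qed
qed

lemma htimes_nat:
  assumes "a \<in> hnat" "b \<in> hnat"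
  shows "\<forall>\<^sub>F d in gen. nat_part (d (htimes a b)) = nat_part (d a) * nat_part (d b)"
  using htimes_value[OF assms] by eventually_elim simp

lemma hdiv_nat:
  assumes "a \<in> hnat" "b \<in> hnat"
  shows "\<forall>\<^sub>F d in gen. nat_part (d (hdiv a b)) = nat_part (d a) div nat_part (d b)"
  using hdiv_value[OF assms] by eventually_elim simp

lemma htimes_hnat:
  assumes "a \<in> hnat" "b \<in> hnat"
  shows "htimes a b \<in> hnat"
  by (rule hnatI[OF htimes_value[OF assms]])
    (use hnat_pos[OF assms(1)] hnat_pos[OF assms(2)] in eventually_elim, simp)

lemma hdiv_hnat:
  assumes "a \<in> hnat" "b \<in> hnat" "hle b a"
  shows "hdiv a b \<in> hnat"
proof (rule hnatI[OF hdiv_value[OF assms(1,2)]])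
  have "\<forall>\<^sub>F d in gen. nat_part (d b) \<le> nat_part (d a)" using hle_iff assms by blast
  then show "\<forall>\<^sub>F d in gen. 1 \<le> nat_part (d a) div nat_part (d b)"
    using hnat_pos[OF assms(2)] by eventually_elim (simp add: Suc_le_eq div_greater_zero_iff)
qed

lemma emb_nat: "\<forall>\<^sub>F d in gen. nat_part (d (emb (SNat n))) = n"
  using emb_value[of "SNat n"] by eventually_elim simp

lemma emb_hnat: "1 \<le> n \<Longrightarrow> emb (SNat n) \<in> hnat"
  by (rule hnatI[OF emb_value]) simp

lemma hseg_iff:
  assumes "a \<in> hnat" "b \<in> hnat"
  shows "x \<in> hseg a b \<longleftrightarrow> x \<in> hnat \<and>
    (\<forall>\<^sub>F d in gen. nat_part (d a) \<le> nat_part (d x) \<and> nat_part (d x) \<le> nat_part (d b))"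
  unfolding hseg_def mem_Collect_eq eventually_conj_iff
  using hle_iff[OF assms(1)] hle_iff[OF _ assms(2)] by blast

end

section \<open>Multiplicative cuts and their classes\<close>

locale nonstd_cut = nonstd star for star :: "std list set \<Rightarrow> 'h list set" +
  fixes V :: "'h set" and N :: 'h
  assumes cut: "mult_cut V" and above: "N \<in> hnat - V"
begin

lemma cut_hnat: "v \<in> V \<Longrightarrow> v \<in> hnat"
  using cut by (auto simp: mult_cut_def)

lemma cut_down:
  assumes "v \<in> V" "b \<in> hnat" "\<forall>\<^sub>F d in gen. nat_part (d b) \<le> nat_part (d v)"
  shows "b \<in> V"
proof -
  have "hle b v" using hle_iff[OF assms(2) cut_hnat[OF assms(1)]] assms(3) by simp
  then show ?thesis using cut assms(1,2) unfolding mult_cut_def by blast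
qed

lemma cut_times: "v \<in> V \<Longrightarrow> w \<in> V \<Longrightarrow> htimes v w \<in> V"
  using cut by (simp add: mult_cut_def)

lemma cut_less:
  assumes "v \<in> V" "r \<in> hnat - V"
  shows "\<forall>\<^sub>F d in gen. nat_part (d v) < nat_part (d r)"
proof -
  have r: "r \<in> hnat" using assms by simp
  have "\<not> hle r v"
    using cut_down[OF assms(1) r] assms(2) hle_iff[OF r cut_hnat[OF assms(1)]] by blast
  then show ?thesis using not_hle_iff[OF r cut_hnat[OF assms(1)]] by simp
qed

lemma two_in_cut: "emb (SNat 2) \<in> V"
proof -
  have "infinite V" using cut unfolding mult_cut_def by blast
  then obtain v where v: "v \<in> V" "v \<noteq> emb (SNat 1)"
    by (metis finite.emptyI finite.insertI insert_iff rev_finite_subset subsetI)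
  have h: "v \<in> hnat" "emb (SNat 1) \<in> hnat" using v cut_hnat emb_hnat by auto
  have "\<not> (\<forall>\<^sub>F d in gen. nat_part (d v) = 1)"
  proof
    assume "\<forall>\<^sub>F d in gen. nat_part (d v) = 1"
    with emb_nat[of 1] have "\<forall>\<^sub>F d in gen. nat_part (d v) = nat_part (d (emb (SNat 1)))"
      by eventually_elim simp
    then show False using hnat_eqI h v by blast
  qed
  then have "\<forall>\<^sub>F d in gen. nat_part (d v) \<noteq> 1"
    by (subst gen_ultra, intro finitaryI[of "{v}"]) simp_all
  with hnat_pos[OF h(1)] emb_nat[of 2]
  have "\<forall>\<^sub>F d in gen. nat_part (d (emb (SNat 2))) \<le> nat_part (d v)" by eventually_elim simp
  then show ?thesis by (intro cut_down[OF v(1) emb_hnat]) simp_all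
qed

lemma cut_power:
  assumes "v \<in> V"
  obtains w where "w \<in> V" "\<forall>\<^sub>F d in gen. nat_part (d w) = nat_part (d v) ^ Suc m"
proof -
  have "\<exists>w\<in>V. \<forall>\<^sub>F d in gen. nat_part (d w) = nat_part (d v) ^ Suc m"
  proof (induction m)
    case 0
    then show ?case using assms by (intro bexI[of _ v]) simp_all
  next
    case (Suc m)
    then obtain w where w: "w \<in> V" "\<forall>\<^sub>F d in gen. nat_part (d w) = nat_part (d v) ^ Suc m" by blast
    have "\<forall>\<^sub>F d in gen. nat_part (d (htimes v w)) = nat_part (d v) ^ Suc (Suc m)"
      using w(2) htimes_nat[OF cut_hnat[OF assms] cut_hnat[OF w(1)]] by eventually_elim simp
    then show ?case using cut_times[OF assms w(1)] by blast
  qed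
  then show ?thesis using that by blast
qed

text \<open>\<open>V\<close> contains all powers of 2 with standard exponent, so whatever lies above
  it is infinite. Hence every \<open>r\<close> above the cut can serve as the ratio of a Loeb
  measure.\<close>

lemma above_cut_large:
  assumes "r \<in> hnat - V"
  shows "\<forall>\<^sub>F d in gen. n \<le> nat_part (d r)"
proof -
  obtain w where w: "w \<in> V" "\<forall>\<^sub>F d in gen. nat_part (d w) = nat_part (d (emb (SNat 2))) ^ Suc n"
    using cut_power[OF two_in_cut] by blast
  show ?thesis using w(2) emb_nat[of 2] cut_less[OF w(1) assms]
  proof eventually_elim
    case (elim d)
    have "n \<le> 2 ^ Suc n" using less_exp[of "Suc n"] by linarith
    then show ?case using elim by simp
  qed
qed

text \<open>A symmetric multiplicative bound replaces the integer quotient because it composes under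
  products. Rounding costs a factor of at most 2, which \<open>V\<close> absorbs.\<close>

lemma veq_iff:
  assumes "a \<in> hnat" "b \<in> hnat"
  shows "veq V a b \<longleftrightarrow> (\<exists>u\<in>V. \<forall>\<^sub>F d in gen. nat_part (d a) \<le> nat_part (d u) * nat_part (d b) \<and>
    nat_part (d b) \<le> nat_part (d u) * nat_part (d a))"
proof
  have *: "\<exists>u\<in>V. \<forall>\<^sub>F d in gen. nat_part (d a) \<le> nat_part (d u) * nat_part (d b) \<and>
    nat_part (d b) \<le> nat_part (d u) * nat_part (d a)"
    if "a \<in> hnat" "b \<in> hnat" "hle a b" "hdiv b a \<in> V" for a b
  proof
    let ?u = "htimes (emb (SNat 2)) (hdiv b a)"
    show "?u \<in> V" using cut_times two_in_cut that by blast
    have "\<forall>\<^sub>F d in gen. nat_part (d a) \<le> nat_part (d b)" using hle_iff that by blast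
    then show "\<forall>\<^sub>F d in gen. nat_part (d a) \<le> nat_part (d ?u) * nat_part (d b) \<and>
        nat_part (d b) \<le> nat_part (d ?u) * nat_part (d a)"
      using htimes_nat[OF cut_hnat[OF two_in_cut] cut_hnat[OF that(4)]] hdiv_nat[OF that(2,1)]
        emb_nat[of 2] hnat_pos[OF that(1)] hnat_pos[OF cut_hnat[OF that(4)]]
    proof eventually_elim
      case (elim d)
      define x y q where "x = nat_part (d a)" and "y = nat_part (d b)" and "q = y div x"
      have q: "1 \<le> q" "x \<le> y" "1 \<le> x" using elim by (auto simp: x_def y_def q_def)
      have "y < (q + 1) * x" unfolding q_def using q by (metis Suc_eq_plus1 Suc_le_eq One_nat_def dividend_less_times_div mult.commute mult_Suc)
      also have "\<dots> \<le> 2 * q * x" using q by (intro mult_le_mono1) simp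
      finally have "y \<le> 2 * q * x" by simp
      moreover have "x \<le> 2 * q * y" using q by (metis le_trans mult_le_mono1 mult_1 mult.assoc one_le_numeral nat_mult_1)
      moreover have "nat_part (d ?u) = 2 * q" using elim by (simp add: x_def y_def q_def)
      ultimately show ?case by (simp add: x_def y_def)
    qed
  qed
  assume "veq V a b"
  then show "\<exists>u\<in>V. \<forall>\<^sub>F d in gen. nat_part (d a) \<le> nat_part (d u) * nat_part (d b) \<and>
    nat_part (d b) \<le> nat_part (d u) * nat_part (d a)"
    using *[of a b] *[of b a] assms unfolding veq_def by (auto simp: conj_commute)
next
  have *: "hdiv b a \<in> V" if "a \<in> hnat" "b \<in> hnat" "hle a b" "u \<in> V"
    "\<forall>\<^sub>F d in gen. nat_part (d b) \<le> nat_part (d u) * nat_part (d a)" for a b u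
  proof (rule cut_down[OF that(4) hdiv_hnat[OF that(2,1,3)]])
    show "\<forall>\<^sub>F d in gen. nat_part (d (hdiv b a)) \<le> nat_part (d u)"
      using hdiv_nat[OF that(2,1)] that(5) hnat_pos[OF that(1)]
    proof eventually_elim
      case (elim d)
      have "nat_part (d b) div nat_part (d a) \<le> nat_part (d u) * nat_part (d a) div nat_part (d a)"
        using elim(2) by (rule div_le_mono)
      then show ?case using elim by simp
    qed
  qed
  assume "\<exists>u\<in>V. \<forall>\<^sub>F d in gen. nat_part (d a) \<le> nat_part (d u) * nat_part (d b) \<and>
    nat_part (d b) \<le> nat_part (d u) * nat_part (d a)"
  then obtain u where u: "u \<in> V" "\<forall>\<^sub>F d in gen. nat_part (d a) \<le> nat_part (d u) * nat_part (d b)"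
    "\<forall>\<^sub>F d in gen. nat_part (d b) \<le> nat_part (d u) * nat_part (d a)"
    by (auto simp: eventually_conj_iff)
  show "veq V a b"
  proof (cases "hle a b")
    case True
    then show ?thesis using * u assms unfolding veq_def by blast
  next
    case False
    then have "\<forall>\<^sub>F d in gen. nat_part (d b) < nat_part (d a)" using not_hle_iff assms by blast
    then have "\<forall>\<^sub>F d in gen. nat_part (d b) \<le> nat_part (d a)" by eventually_elim simp
    then have "hle b a" using hle_iff assms by blast
    then show ?thesis using * u assms unfolding veq_def by blast
  qed
qed

lemma veq_refl:
  assumes "a \<in> hnat"
  shows "veq V a a"
proof -
  have "\<forall>\<^sub>F d in gen. nat_part (d a) \<le> nat_part (d (emb (SNat 2))) * nat_part (d a) \<and>
    nat_part (d a) \<le> nat_part (d (emb (SNat 2))) * nat_part (d a)"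
    using emb_nat[of 2] by eventually_elim simp
  then show ?thesis unfolding veq_iff[OF assms assms] by (rule bexI[OF _ two_in_cut])
qed

lemma veq_sym: "veq V a b \<longleftrightarrow> veq V b a"
  unfolding veq_def by auto

lemma veq_trans:
  assumes "a \<in> hnat" "b \<in> hnat" "c \<in> hnat" "veq V a b" "veq V b c"
  shows "veq V a c"
proof -
  obtain u where u: "u \<in> V" "\<forall>\<^sub>F d in gen. nat_part (d a) \<le> nat_part (d u) * nat_part (d b) \<and>
    nat_part (d b) \<le> nat_part (d u) * nat_part (d a)" using assms veq_iff by blast
  obtain v where v: "v \<in> V" "\<forall>\<^sub>F d in gen. nat_part (d b) \<le> nat_part (d v) * nat_part (d c) \<and>
    nat_part (d c) \<le> nat_part (d v) * nat_part (d b)" using assms veq_iff by blast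
  have "\<forall>\<^sub>F d in gen. nat_part (d a) \<le> nat_part (d (htimes u v)) * nat_part (d c) \<and>
    nat_part (d c) \<le> nat_part (d (htimes u v)) * nat_part (d a)"
    using u(2) v(2) htimes_nat[OF cut_hnat[OF u(1)] cut_hnat[OF v(1)]]
  proof eventually_elim
    case (elim d)
    have "nat_part (d a) \<le> nat_part (d u) * (nat_part (d v) * nat_part (d c))"
      using elim by (meson le_trans mult_le_mono2)
    moreover have "nat_part (d c) \<le> nat_part (d v) * (nat_part (d u) * nat_part (d a))"
      using elim by (meson le_trans mult_le_mono2)
    ultimately show ?case using elim by (simp add: ac_simps)
  qed
  then show ?thesis using veq_iff assms cut_times[OF u(1) v(1)] by blast
qed

lemma cls_eq_iff:
  assumes "a \<in> hnat" "b \<in> hnat"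
  shows "cls V a = cls V b \<longleftrightarrow> veq V a b"
proof
  assume "cls V a = cls V b"
  moreover have "b \<in> cls V b" using veq_refl assms by (simp add: cls_def)
  ultimately show "veq V a b" by (auto simp: cls_def)
next
  assume "veq V a b"
  then show "cls V a = cls V b"
    unfolding cls_def using veq_trans[of a b] veq_trans[of b a] veq_sym[of a b] assms by blast
qed

lemma cls_mem: "a \<in> hnat \<Longrightarrow> a \<in> cls V a"
  using veq_refl by (simp add: cls_def)

lemma vtimes_cls:
  assumes "r \<in> hnat" "b \<in> hnat"
  shows "vtimes V (cls V r) (cls V b) = cls V (htimes r b)"
proof -
  have "cls V (htimes r' b') = cls V (htimes r b)" if "r' \<in> cls V r" "b' \<in> cls V b" for r' b'
  proof -
    have h: "r' \<in> hnat" "b' \<in> hnat" "veq V r r'" "veq V b b'" using that by (auto simp: cls_def)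
    obtain u where u: "u \<in> V" "\<forall>\<^sub>F d in gen. nat_part (d r) \<le> nat_part (d u) * nat_part (d r') \<and>
      nat_part (d r') \<le> nat_part (d u) * nat_part (d r)" using h assms veq_iff by blast
    obtain v where v: "v \<in> V" "\<forall>\<^sub>F d in gen. nat_part (d b) \<le> nat_part (d v) * nat_part (d b') \<and>
      nat_part (d b') \<le> nat_part (d v) * nat_part (d b)" using h assms veq_iff by blast
    have "\<forall>\<^sub>F d in gen. nat_part (d (htimes r' b')) \<le> nat_part (d (htimes u v)) * nat_part (d (htimes r b)) \<and>
      nat_part (d (htimes r b)) \<le> nat_part (d (htimes u v)) * nat_part (d (htimes r' b'))"
      using u(2) v(2) htimes_nat[OF cut_hnat[OF u(1)] cut_hnat[OF v(1)]]
        htimes_nat[OF assms] htimes_nat[OF h(1,2)]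
    proof eventually_elim
      case (elim d)
      have "nat_part (d r) * nat_part (d b) \<le> nat_part (d u) * nat_part (d r') * (nat_part (d v) * nat_part (d b'))"
        using elim by (intro mult_le_mono) auto
      moreover have "nat_part (d r') * nat_part (d b') \<le> nat_part (d u) * nat_part (d r) * (nat_part (d v) * nat_part (d b))"
        using elim by (intro mult_le_mono) auto
      ultimately show ?case using elim by (simp add: ac_simps)
    qed
    then have "veq V (htimes r' b') (htimes r b)"
      using veq_iff htimes_hnat h assms cut_times[OF u(1) v(1)] by blast
    then show ?thesis using cls_eq_iff htimes_hnat h assms by blast
  qed
  then show ?thesis using cls_mem assms unfolding vtimes_def by blast
qed

text \<open>The case to exclude is that representatives are ordered against \<open>a\<close> and
  \<open>b\<close>. If \<open>b\<close> is below \<open>a\<close> but \<open>a'\<close> is below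
  \<open>b'\<close>, then \<open>a \<le> u * a' \<le> u * v * b\<close> with \<open>u\<close> and
  \<open>v\<close> in \<open>V\<close>, so the two classes coincide.\<close>

lemma vle_cls_iff:
  assumes "a \<in> hnat" "b \<in> hnat"
  shows "vle V (cls V a) (cls V b) \<longleftrightarrow> hle a b \<or> veq V a b"
proof
  assume "vle V (cls V a) (cls V b)"
  then consider "veq V a b" | "vless V (cls V a) (cls V b)"
    using cls_eq_iff assms unfolding vle_def by blast
  then show "hle a b \<or> veq V a b"
  proof cases
    case 2
    then obtain a' b' where h: "a' \<in> hnat" "b' \<in> hnat" "veq V a a'" "veq V b b'" "hless a' b'"
      unfolding vless_def cls_def by blast
    show ?thesis
    proof (cases "hle a b")
      case False
      obtain u where u: "u \<in> V" "\<forall>\<^sub>F d in gen. nat_part (d a) \<le> nat_part (d u) * nat_part (d a') \<and>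
        nat_part (d a') \<le> nat_part (d u) * nat_part (d a)" using h assms veq_iff by blast
      obtain v where v: "v \<in> V" "\<forall>\<^sub>F d in gen. nat_part (d b) \<le> nat_part (d v) * nat_part (d b') \<and>
        nat_part (d b') \<le> nat_part (d v) * nat_part (d b)" using h assms veq_iff by blast
      have "\<forall>\<^sub>F d in gen. nat_part (d b) < nat_part (d a)" using not_hle_iff assms False by blast
      moreover have "\<forall>\<^sub>F d in gen. nat_part (d a') < nat_part (d b')" using hless_iff h by blast
      ultimately have "\<forall>\<^sub>F d in gen. nat_part (d a) \<le> nat_part (d (htimes u v)) * nat_part (d b) \<and>
        nat_part (d b) \<le> nat_part (d (htimes u v)) * nat_part (d a)"
        using u(2) v(2) htimes_nat[OF cut_hnat[OF u(1)] cut_hnat[OF v(1)]]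
          hnat_pos[OF cut_hnat[OF u(1)]] hnat_pos[OF cut_hnat[OF v(1)]]
      proof eventually_elim
        case (elim d)
        have "nat_part (d a) \<le> nat_part (d u) * nat_part (d a')" using elim by simp
        also have "\<dots> \<le> nat_part (d u) * (nat_part (d v) * nat_part (d b))"
          using elim by (intro mult_le_mono2) simp
        finally have 1: "nat_part (d a) \<le> nat_part (d (htimes u v)) * nat_part (d b)"
          using elim by simp
        have "1 * nat_part (d b) \<le> nat_part (d (htimes u v)) * nat_part (d a)"
          using elim by (intro mult_le_mono) simp_all
        then show ?case using 1 by simp
      qed
      then show ?thesis using veq_iff assms cut_times[OF u(1) v(1)] by blast
    qed simp
  qed simp
next
  assume "hle a b \<or> veq V a b"
  then consider "veq V a b" | "hle a b" "\<not> veq V a b" by blast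
  then show "vle V (cls V a) (cls V b)"
  proof cases
    case 1
    then show ?thesis using cls_eq_iff assms unfolding vle_def by blast
  next
    case 2
    then have "hless a b" using veq_refl assms unfolding hless_def by blast
    then show ?thesis using 2 cls_mem assms unfolding vle_def vless_def by blast
  qed
qed

text \<open>If the gap stayed open, the cut would be an internal set and hence have a maximum.\<close>

lemma cut_gap:
  fixes F :: "('h \<Rightarrow> std) \<Rightarrow> nat \<Rightarrow> real"
  assumes F: "finitary F" and bound: "\<forall>\<^sub>F d in gen. \<forall>n. 1 \<le> n \<and> n \<le> nat_part (d N) \<longrightarrow> F d n \<le> K"
    and nonneg: "\<And>d n. 0 \<le> F d n" and "0 < \<epsilon>"
  obtains v s where "v \<in> V" "s \<in> hnat - V" "hle s N"
    "\<forall>\<^sub>F d in gen. F d (nat_part (d s)) < F d (nat_part (d v)) + \<epsilon>"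
proof -
  have fin: "finitary (\<lambda>d. P (F d) (nat_part (d x)) (nat_part (d y)))" for P :: "(nat \<Rightarrow> real) \<Rightarrow> nat \<Rightarrow> nat \<Rightarrow> bool" and x y
  proof -
    obtain S where S: "finite S" "\<And>d d'. (\<forall>a\<in>S. d a = d' a) \<Longrightarrow> F d = F d'"
      using F unfolding finitary_def by blast
    show ?thesis
    proof (rule finitaryI[of "insert x (insert y S)"])
      fix d d' :: "'h \<Rightarrow> std" assume "\<forall>a\<in>insert x (insert y S). d a = d' a"
      then have "F d = F d'" "d x = d' x" "d y = d' y" using S(2)[of d d'] by simp_all
      then show "P (F d) (nat_part (d x)) (nat_part (d y)) = P (F d') (nat_part (d' x)) (nat_part (d' y))"
        by simp
    qed (use S(1) in simp)
  qed
  have "\<exists>v\<in>V. \<exists>s\<in>hnat - V. hle s N \<and> (\<forall>\<^sub>F d in gen. F d (nat_part (d s)) < F d (nat_part (d v)) + \<epsilon>)"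
  proof (rule ccontr)
    assume neg: "\<not> ?thesis"
    have far: "\<forall>\<^sub>F d in gen. F d (nat_part (d v)) + \<epsilon> \<le> F d (nat_part (d s))"
      if "v \<in> V" "s \<in> hnat - V" "hle s N" for v s
    proof -
      have "\<not> (\<forall>\<^sub>F d in gen. F d (nat_part (d s)) < F d (nat_part (d v)) + \<epsilon>)" using neg that by blast
      then have "\<forall>\<^sub>F d in gen. \<not> F d (nat_part (d s)) < F d (nat_part (d v)) + \<epsilon>"
        using gen_ultra[OF fin[of "\<lambda>F x y. F x < F y + \<epsilon>" s v]] by blast
      then show ?thesis by eventually_elim simp
    qed
    \<comment> \<open>The standard levels that \<open>F\<close> reaches somewhere on
      \<open>V\<close>; \<open>bound\<close> keeps them below \<open>K\<close>.\<close>
    define T where "T = {q. \<exists>v\<in>V. \<forall>\<^sub>F d in gen. q \<le> F d (nat_part (d v))}"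
    have T0: "0 \<in> T" unfolding T_def using two_in_cut nonneg by auto
    have TK: "q \<le> K" if "q \<in> T" for q
    proof -
      obtain v where v: "v \<in> V" "\<forall>\<^sub>F d in gen. q \<le> F d (nat_part (d v))" using \<open>q \<in> T\<close> unfolding T_def by blast
      have "\<forall>\<^sub>F d in gen. q \<le> K"
        using v(2) bound cut_less[OF v(1) above] hnat_pos[OF cut_hnat[OF v(1)]]
      proof eventually_elim
        case (elim d)
        then have "F d (nat_part (d v)) \<le> K" by simp
        then show ?case using elim(1) by linarith
      qed
      then show ?thesis by simp
    qed
    have bdd: "bdd_above T" using TK by (auto simp: bdd_above_def)
    \<comment> \<open>This level separates the two sides: nothing in \<open>V\<close> reaches it,
      while \<open>F\<close> at a point above \<open>V\<close> and up to \<open>N\<close> is at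
      least \<open>t + \<epsilon>\<close>, for a \<open>t\<close> in \<open>T\<close> with
      \<open>t > Sup T - \<epsilon> / 2\<close>.\<close>
    define q where "q = Sup T + \<epsilon> / 2"
    have "Sup T - \<epsilon> / 2 < Sup T" using \<open>0 < \<epsilon>\<close> by simp
    then obtain t where t: "t \<in> T" "Sup T - \<epsilon> / 2 < t" using less_cSup_iff[OF _ bdd] T0 by blast
    obtain v0 where v0: "v0 \<in> V" "\<forall>\<^sub>F d in gen. t \<le> F d (nat_part (d v0))" using t unfolding T_def by blast
    have inV: "\<forall>\<^sub>F d in gen. F d (nat_part (d v)) < q" if "v \<in> V" for v
    proof -
      have "q \<notin> T"
      proof
        assume "q \<in> T"
        then have "q \<le> Sup T" by (rule cSup_upper[OF _ bdd])
        then show False using \<open>0 < \<epsilon>\<close> by (simp add: q_def)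
      qed
      then have "\<not> (\<forall>\<^sub>F d in gen. q \<le> F d (nat_part (d v)))" using \<open>v \<in> V\<close> unfolding T_def by blast
      then have "\<forall>\<^sub>F d in gen. \<not> q \<le> F d (nat_part (d v))"
        using gen_ultra[OF fin[of "\<lambda>F x y. q \<le> F x" v v]] by blast
      then show ?thesis by eventually_elim simp
    qed
    have outV: "\<forall>\<^sub>F d in gen. q \<le> F d (nat_part (d s))" if "s \<in> hnat - V" "hle s N" for s
      using far[OF v0(1) that] v0(2)
    proof eventually_elim
      case (elim d)
      then show ?case using t(2) unfolding q_def by linarith
    qed
    \<comment> \<open>By the separation this random finite set represents exactly \<open>V\<close>,
      which is how the cut would become internal.\<close>
    define S where "S d = {n. 1 \<le> n \<and> n \<le> nat_part (d N) \<and> F d n < q}" for d :: "'h \<Rightarrow> std"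
    have finS: "finite (S d)" for d by (rule finite_subset[of _ "{..nat_part (d N)}"]) (auto simp: S_def)
    have "finitary (\<lambda>d. SNat (Max (S d)))"
    proof -
      obtain R where R: "finite R" "\<And>d d'. (\<forall>a\<in>R. d a = d' a) \<Longrightarrow> F d = F d'"
        using F unfolding finitary_def by blast
      show ?thesis
      proof (rule finitaryI[of "insert N R"])
        fix d d' :: "'h \<Rightarrow> std" assume "\<forall>a\<in>insert N R. d a = d' a"
        then have "F d = F d'" "d N = d' N" using R(2)[of d d'] by simp_all
        then show "SNat (Max (S d)) = SNat (Max (S d'))" by (simp add: S_def)
      qed (use R(1) in simp)
    qed
    then obtain m where m: "\<forall>\<^sub>F d in gen. d m = SNat (Max (S d))" by (rule gen_value)
    have mem: "\<forall>\<^sub>F d in gen. nat_part (d v) \<in> S d" if "v \<in> V" for v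
      using inV[OF that] cut_less[OF that above] hnat_pos[OF cut_hnat[OF that]]
      by eventually_elim (simp add: S_def)
    have mS: "\<forall>\<^sub>F d in gen. nat_part (d m) \<in> S d"
      using m mem[OF two_in_cut]
    proof eventually_elim
      case (elim d)
      then show ?case using Max_in[OF finS] by auto
    qed
    have "\<forall>\<^sub>F d in gen. 1 \<le> Max (S d)" using mS m by eventually_elim (simp add: S_def)
    then have mh: "m \<in> hnat" using hnatI[OF m] by blast
    have mV: "m \<in> V"
    proof (rule ccontr)
      assume "m \<notin> V"
      moreover have "\<forall>\<^sub>F d in gen. nat_part (d m) \<le> nat_part (d N)"
        using mS by eventually_elim (simp add: S_def)
      then have "hle m N" using hle_iff mh above by blast
      ultimately have "\<forall>\<^sub>F d in gen. q \<le> F d (nat_part (d m))" using outV mh by blast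
      with mS have "\<forall>\<^sub>F d in gen. False" by eventually_elim (simp add: S_def)
      then show False by simp
    qed
    \<comment> \<open>Twice the maximum is still in \<open>V\<close>, hence in the set of which
      \<open>m\<close> is the maximum.\<close>
    let ?t = "htimes (emb (SNat 2)) m"
    have "?t \<in> V" using cut_times two_in_cut mV by blast
    have "\<forall>\<^sub>F d in gen. False"
      using mem[OF \<open>?t \<in> V\<close>] htimes_nat[OF cut_hnat[OF two_in_cut] mh] emb_nat[of 2] m hnat_pos[OF mh]
    proof eventually_elim
      case (elim d)
      have "nat_part (d ?t) \<le> Max (S d)" using Max_ge[OF finS elim(1)] .
      then show False using elim by simp
    qed
    then show False by simp
  qed
  then show ?thesis using that by blast
qed

end

section \<open>Loeb measures\<close>

context nonstd begin

text \<open>For finitary \<open>f\<close> these sets are internal, and every internal subset of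
  \<open>hnat\<close> has this form. The conjunct about \<open>SNat\<close> excludes the other
  sorts, on which \<open>nat_part\<close> takes the default value 0.\<close>

definition iset :: "(('h \<Rightarrow> std) \<Rightarrow> nat set) \<Rightarrow> 'h set" where
  "iset f = {x. \<forall>\<^sub>F d in gen. d x = SNat (nat_part (d x)) \<and> nat_part (d x) \<in> f d}"

lemma iset_mono: "\<forall>\<^sub>F d in gen. f d \<subseteq> g d \<Longrightarrow> iset f \<subseteq> iset g"
proof
  fix x assume *: "\<forall>\<^sub>F d in gen. f d \<subseteq> g d" "x \<in> iset f"
  have "\<forall>\<^sub>F d in gen. d x = SNat (nat_part (d x)) \<and> nat_part (d x) \<in> f d"
    using *(2) by (simp add: iset_def)
  with *(1) show "x \<in> iset g"
    unfolding iset_def mem_Collect_eq by eventually_elim blast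
qed

lemma iset_cong: "\<forall>\<^sub>F d in gen. f d = g d \<Longrightarrow> iset f = iset g"
  by (intro equalityI iset_mono; erule eventually_mono) auto

lemma iset_mem_finitary: "finitary f \<Longrightarrow> finitary (\<lambda>d. d x = SNat (nat_part (d x)) \<and> nat_part (d x) \<in> f d)"
  by (rule finitary_comp2[OF finitary_coord[of x], of f "\<lambda>u S. u = SNat (nat_part u) \<and> nat_part u \<in> S"])

text \<open>An internal set determines its values up to the filter: if the inclusion failed, the
  ultrafilter property would make it fail eventually, and \<open>gen_ex\<close> would combine the
  missing points into an element of \<open>iset f\<close> outside \<open>iset g\<close>.\<close>

lemma iset_subsetD:
  assumes "finitary f" "finitary g" "iset f \<subseteq> iset g"
  shows "\<forall>\<^sub>F d in gen. f d \<subseteq> g d"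
proof (rule ccontr)
  assume "\<not> ?thesis"
  then have "\<forall>\<^sub>F d in gen. \<not> f d \<subseteq> g d"
    using gen_ultra[OF finitary_comp2[OF assms(1,2), of "\<lambda>S T. S \<subseteq> T"]] by blast
  then have "\<forall>\<^sub>F d in gen. \<exists>x. x = SNat (nat_part x) \<and> nat_part x \<in> f d \<and> nat_part x \<notin> g d"
  proof eventually_elim
    case (elim d)
    then obtain n where "n \<in> f d" "n \<notin> g d" by blast
    then show ?case by (intro exI[of _ "SNat n"]) simp
  qed
  then obtain y where y: "\<forall>\<^sub>F d in gen. d y = SNat (nat_part (d y)) \<and> nat_part (d y) \<in> f d \<and> nat_part (d y) \<notin> g d"
    by (rule gen_ex[OF finitary_comp2[OF assms(1,2), of "\<lambda>S T x. x = SNat (nat_part x) \<and> nat_part x \<in> S \<and> nat_part x \<notin> T"]])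
  then have "y \<in> iset f" unfolding iset_def mem_Collect_eq by (rule eventually_mono) simp
  then have "y \<in> iset g" using assms(3) by blast
  then have "\<forall>\<^sub>F d in gen. d y = SNat (nat_part (d y)) \<and> nat_part (d y) \<in> g d" by (simp add: iset_def)
  with y have "\<forall>\<^sub>F d in gen. False" by eventually_elim simp
  then show False by simp
qed

lemma iset_eqD:
  assumes "finitary f" "finitary g" "iset f = iset g"
  shows "\<forall>\<^sub>F d in gen. f d = g d"
  using iset_subsetD[OF assms(1,2)] iset_subsetD[OF assms(2,1)] assms(3)
  by (simp add: set_eq_subset eventually_conj_iff)

text \<open>The inclusion of the union in the two parts is the one with content: the values of a
  point could switch between \<open>f d\<close> and \<open>g d\<close> with \<open>d\<close>, and
  the ultrafilter property decides for one of them.\<close>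

lemma iset_Un:
  assumes "finitary f" "finitary g"
  shows "iset (\<lambda>d. f d \<union> g d) = iset f \<union> iset g"
proof
  show "iset (\<lambda>d. f d \<union> g d) \<subseteq> iset f \<union> iset g"
  proof
    fix x assume "x \<in> iset (\<lambda>d. f d \<union> g d)"
    then have x: "\<forall>\<^sub>F d in gen. d x = SNat (nat_part (d x)) \<and> nat_part (d x) \<in> f d \<union> g d"
      by (simp add: iset_def)
    show "x \<in> iset f \<union> iset g"
    proof (cases "x \<in> iset f")
      case False
      then have "\<forall>\<^sub>F d in gen. \<not> (d x = SNat (nat_part (d x)) \<and> nat_part (d x) \<in> f d)"
        using gen_ultra[OF iset_mem_finitary[OF assms(1), of x]] by (simp add: iset_def)
      with x have "\<forall>\<^sub>F d in gen. d x = SNat (nat_part (d x)) \<and> nat_part (d x) \<in> g d"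
        by eventually_elim blast
      then show ?thesis by (simp add: iset_def)
    qed simp
  qed
  show "iset f \<union> iset g \<subseteq> iset (\<lambda>d. f d \<union> g d)"
    by (intro Un_least iset_mono) simp_all
qed

lemma iset_Int: "iset (\<lambda>d. f d \<inter> g d) = iset f \<inter> iset g"
  unfolding iset_def by (auto simp: eventually_conj_iff)

lemma iset_empty: "iset (\<lambda>d. {}) = {}"
  by (simp add: iset_def)

lemma internal_iset:
  assumes "finitary f"
  shows "internal star (iset f)"
  unfolding iset_def
  by (rule internal_gen[of "\<lambda>d x. x = SNat (nat_part x) \<and> nat_part x \<in> f d"]) (rule finitary_comp[OF assms])

lemma internal_is_iset:
  assumes "internal star C" "C \<subseteq> hnat"
  obtains f where "finitary f" "C = iset f"
proof -
  obtain Q where Q: "finitary Q" "C = {x. \<forall>\<^sub>F d in gen. Q d (d x)}"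
    by (rule internalE[OF assms(1)])
  have "C = iset (\<lambda>d. {n. Q d (SNat n)})"
  proof (rule set_eqI, rule iffI)
    fix x assume x: "x \<in> C"
    then have "x \<in> hnat" using assms by blast
    then have "\<forall>\<^sub>F d in gen. d x = SNat (nat_part (d x))" by (rule hnat_value)
    moreover have "\<forall>\<^sub>F d in gen. Q d (d x)" using x Q(2) by simp
    ultimately show "x \<in> iset (\<lambda>d. {n. Q d (SNat n)})"
      unfolding iset_def mem_Collect_eq
    proof eventually_elim
      case (elim d)
      then show ?case by metis
    qed
  next
    fix x assume "x \<in> iset (\<lambda>d. {n. Q d (SNat n)})"
    then have "\<forall>\<^sub>F d in gen. d x = SNat (nat_part (d x)) \<and> Q d (SNat (nat_part (d x)))"
      by (simp add: iset_def)
    then have "\<forall>\<^sub>F d in gen. Q d (d x)"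
    proof eventually_elim
      case (elim d)
      then show ?case by metis
    qed
    then show "x \<in> C" using Q(2) by simp
  qed
  moreover have "finitary (\<lambda>d. {n. Q d (SNat n)})" by (rule finitary_comp[OF Q(1)])
  ultimately show ?thesis using that by blast
qed

text \<open>Uniqueness of the code is extensionality of internal sets: by \<open>iset_eqD\<close>
  two codes of one set have eventually equal values, and then they are equal.\<close>

lemma hcode_iset:
  assumes f: "finitary f" and c: "\<forall>\<^sub>F d in gen. d c = SSet (f d)"
  shows "hcode (iset f) = c"
  unfolding hcode_def
proof (rule the_equality)
  have set_iff: "[c'] \<in> star {[SSet S] | S. True} \<longleftrightarrow> (\<forall>\<^sub>F d in gen. d c' = SSet (set_part (d c')))" for c'
  proof -
    have "map d [c'] \<in> {[SSet S] | S. True} \<longleftrightarrow> d c' = SSet (set_part (d c'))" for d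
      by (cases "d c'") auto
    then show ?thesis unfolding eventually_star[symmetric] by simp
  qed
  have mem_iff: "{x. [x, c'] \<in> star {[SNat n, SSet S] | n S. n \<in> S}} = iset (\<lambda>d. set_part (d c'))"
    if "\<forall>\<^sub>F d in gen. d c' = SSet (set_part (d c'))" for c'
  proof -
    have "[x, c'] \<in> star {[SNat n, SSet S] | n S. n \<in> S} \<longleftrightarrow> x \<in> iset (\<lambda>d. set_part (d c'))" for x
      unfolding eventually_star[symmetric] iset_def mem_Collect_eq
    proof (rule eventually_subst)
      show "\<forall>\<^sub>F d in gen. (\<exists>n S. map d [x, c'] = [SNat n, SSet S] \<and> n \<in> S) \<longleftrightarrow>
          d x = SNat (nat_part (d x)) \<and> nat_part (d x) \<in> set_part (d c')"
        using that
      proof eventually_elim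
        case (elim d)
        then show ?case by (cases "d x"; cases "d c'") auto
      qed
    qed
    then show ?thesis by blast
  qed
  have c1: "\<forall>\<^sub>F d in gen. d c = SSet (set_part (d c))" using c by eventually_elim simp
  have c2: "\<forall>\<^sub>F d in gen. f d = set_part (d c)" using c by eventually_elim simp
  show "[c] \<in> star {[SSet S] | S. True} \<and> iset f = {x. [x, c] \<in> star {[SNat n, SSet S] | n S. n \<in> S}}"
    using set_iff[of c] c1 mem_iff[OF c1] iset_cong[OF c2] by simp
  fix c'
  assume *: "[c'] \<in> star {[SSet S] | S. True} \<and> iset f = {x. [x, c'] \<in> star {[SNat n, SSet S] | n S. n \<in> S}}"
  then have c': "\<forall>\<^sub>F d in gen. d c' = SSet (set_part (d c'))" using set_iff by blast
  have "iset f = iset (\<lambda>d. set_part (d c'))" using * mem_iff[OF c'] by simp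
  then have "\<forall>\<^sub>F d in gen. f d = set_part (d c')"
    by (rule iset_eqD[OF f finitary_comp[OF finitary_coord]])
  with c c' have "\<forall>\<^sub>F d in gen. d c' = d c" by eventually_elim simp
  then show "c' = c" by (rule gen_eq)
qed

lemma hlogsum_value:
  assumes f: "finitary f" and fin: "\<forall>\<^sub>F d in gen. finite (f d)" and M: "M \<in> hnat"
  shows "\<forall>\<^sub>F d in gen. d (hlogsum (iset f) M) = SReal (hsum (f d) / ln (real (nat_part (d M))))"
proof -
  obtain c where c: "\<forall>\<^sub>F d in gen. d c = SSet (f d)"
    using gen_value[OF finitary_SSet[OF f]] by blast
  have code: "hcode (iset f) = c" by (rule hcode_iset[OF f c])
  show ?thesis
    unfolding hlogsum_def code
  proof (rule app_value)
    show "finitary (\<lambda>d. SReal (hsum (f d) / ln (real (nat_part (d M)))))"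
      by (rule finitary_comp2[OF f finitary_coord, of "\<lambda>S u. SReal (hsum S / ln (real (nat_part u)))"])
    show "\<forall>\<^sub>F d in gen. \<forall>y. map d [c, M] @ [y] \<in>
      {[SSet S, SNat m, SReal (\<Sum>a\<in>S. 1 / (real a * ln (real m)))] |S m. finite S} \<longleftrightarrow>
      y = SReal (hsum (f d) / ln (real (nat_part (d M))))"
      using c fin hnat_value[OF M]
    proof eventually_elim
      case (elim d)
      obtain m where m: "d M = SNat m" using elim by blast
      have "hsum S / ln (real m) = (\<Sum>a\<in>S. 1 / (real a * ln (real m)))" for S
        unfolding hsum_def by (simp add: sum_divide_distrib)
      then show ?case using elim m by auto
    qed
  qed
qed

text \<open>The standard part is found as the supremum of the standard reals below the value, a set
  that is nonempty and bounded because the value is finite.\<close>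

lemma st_approx:
  assumes y: "\<forall>\<^sub>F d in gen. d y = SReal (f d)" and f: "\<forall>\<^sub>F d in gen. \<bar>f d\<bar> \<le> K" and "0 < \<epsilon>"
  shows "\<forall>\<^sub>F d in gen. \<bar>f d - st y\<bar> < \<epsilon>"
proof -
  have near: "[y] \<in> star {[SReal x] | x. \<bar>x - r\<bar> < e} \<longleftrightarrow> (\<forall>\<^sub>F d in gen. \<bar>f d - r\<bar> < e)" for r e
    unfolding eventually_star[symmetric]
    by (rule eventually_subst) (use y in eventually_elim, simp)
  have fin: "finitary (\<lambda>d. P (real_part (d y)))" for P :: "real \<Rightarrow> bool"
    by (rule finitary_comp[OF finitary_coord])
  define T where "T = {q. \<forall>\<^sub>F d in gen. q \<le> f d}"
  have "- K \<in> T" unfolding T_def mem_Collect_eq using f by eventually_elim simp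
  then have ne: "T \<noteq> {}" by blast
  have bdd: "bdd_above T"
  proof (rule bdd_aboveI)
    fix q assume "q \<in> T"
    then have "\<forall>\<^sub>F d in gen. q \<le> f d" by (simp add: T_def)
    with f have "\<forall>\<^sub>F d in gen. q \<le> K" by eventually_elim simp
    then show "q \<le> K" by simp
  qed
  define r where "r = Sup T"
  have r: "\<forall>\<^sub>F d in gen. \<bar>f d - r\<bar> < e" if "0 < e" for e
  proof -
    have "r - e / 2 < r" using that by simp
    then obtain t where t: "t \<in> T" "r - e / 2 < t" unfolding r_def using less_cSup_iff[OF ne bdd] by blast
    have "r + e / 2 \<notin> T"
    proof
      assume "r + e / 2 \<in> T"
      then have "r + e / 2 \<le> r" unfolding r_def by (rule cSup_upper[OF _ bdd])
      then show False using that by simp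
    qed
    then have *: "\<not> (\<forall>\<^sub>F d in gen. r + e / 2 \<le> f d)" by (simp add: T_def)
    \<comment> \<open>The ultrafilter property requires a finitary condition, and \<open>f\<close>
      is arbitrary. The coordinate of \<open>y\<close> agrees with \<open>f d\<close> eventually and
      depends on one value only.\<close>
    have "\<not> (\<forall>\<^sub>F d in gen. r + e / 2 \<le> real_part (d y))"
    proof
      assume "\<forall>\<^sub>F d in gen. r + e / 2 \<le> real_part (d y)"
      with y have "\<forall>\<^sub>F d in gen. r + e / 2 \<le> f d" by eventually_elim simp
      then show False using * by blast
    qed
    then have "\<forall>\<^sub>F d in gen. \<not> r + e / 2 \<le> real_part (d y)"
      using gen_ultra[OF fin[of "\<lambda>x. r + e / 2 \<le> x"]] by blast
    moreover have "\<forall>\<^sub>F d in gen. t \<le> f d" using t(1) by (simp add: T_def)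
    ultimately show ?thesis using y
    proof eventually_elim
      case (elim d)
      then show ?case using t(2) by simp
    qed
  qed
  have "st y = r"
    unfolding st_def near
  proof (rule the_equality)
    show "\<forall>\<epsilon>>0. \<forall>\<^sub>F d in gen. \<bar>f d - r\<bar> < \<epsilon>" using r by blast
    fix r' assume r': "\<forall>\<epsilon>>0. \<forall>\<^sub>F d in gen. \<bar>f d - r'\<bar> < \<epsilon>"
    show "r' = r"
    proof (rule ccontr)
      assume "r' \<noteq> r"
      define e where "e = \<bar>r' - r\<bar> / 2"
      have e: "0 < e" using \<open>r' \<noteq> r\<close> by (simp add: e_def)
      have "\<forall>\<^sub>F d in gen. \<bar>f d - r'\<bar> < e" using r' e by blast
      with r[OF e] have "\<forall>\<^sub>F d in gen. False"
      proof eventually_elim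
        case (elim d)
        then show False using abs_triangle_ineq4[of "f d - r" "f d - r'"] by (simp add: e_def)
      qed
      then show False by simp
    qed
  qed
  then show ?thesis using r \<open>0 < \<epsilon>\<close> by simp
qed

end

section \<open>The Loeb measure of a logarithmic interval and its image on classes\<close>

locale loeb_interval = nonstd star for star :: "std list set \<Rightarrow> 'h list set" +
  fixes k M :: 'h
  assumes k: "k \<in> hnat" and M: "M \<in> hnat" and large: "\<And>n. \<forall>\<^sub>F d in gen. n \<le> nat_part (d M)"
begin

definition range_of :: "('h \<Rightarrow> std) \<Rightarrow> nat set" where
  "range_of d = {nat_part (d k)..nat_part (d M) * nat_part (d k)}"

definition mass :: "(('h \<Rightarrow> std) \<Rightarrow> nat set) \<Rightarrow> real" where
  "mass f = st (hlogsum (iset f) M)"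

lemma finitary_range: "finitary range_of"
  unfolding range_of_def
  by (rule finitary_comp2[OF finitary_coord[of k] finitary_coord[of M], of "\<lambda>u v. {nat_part u..nat_part v * nat_part u}"])

lemma finite_range: "finite (range_of d)"
  by (simp add: range_of_def)

lemma hseg_iset: "hseg k (htimes M k) = iset range_of"
proof (rule set_eqI)
  fix x
  note v = htimes_nat[OF M k] hnat_pos[OF k]
  show "x \<in> hseg k (htimes M k) \<longleftrightarrow> x \<in> iset range_of"
    unfolding hseg_iff[OF k htimes_hnat[OF M k]] hnat_iff eventually_conj_iff[symmetric] iset_def mem_Collect_eq
    by (rule eventually_subst) (use v in eventually_elim, auto simp: range_of_def)
qed

lemma ln_large: "\<forall>\<^sub>F d in gen. K \<le> ln (real (nat_part (d M)))"
  using large[of "nat \<lceil>exp K\<rceil>"] large[of 1]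
proof eventually_elim
  case (elim d)
  have "exp K \<le> real (nat_part (d M))" using elim by linarith
  then show ?case using elim by (subst ln_ge_iff) auto
qed

text \<open>The passage between finite sums and real masses, in both directions. The standard part
  exists because the sum over the whole interval is at most
  \<open>1 + ln M \<le> 2 * ln M\<close>.\<close>

lemma mass_approx:
  assumes "finitary f" "\<forall>\<^sub>F d in gen. f d \<subseteq> range_of d" "0 < \<epsilon>"
  shows "\<forall>\<^sub>F d in gen. \<bar>hsum (f d) / ln (real (nat_part (d M))) - mass f\<bar> < \<epsilon>"
proof -
  have fin: "\<forall>\<^sub>F d in gen. finite (f d)"
    using assms(2) by eventually_elim (rule finite_subset[OF _ finite_range])
  have bound: "\<forall>\<^sub>F d in gen. \<bar>hsum (f d) / ln (real (nat_part (d M)))\<bar> \<le> 2"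
    using assms(2) ln_large[of 1] large[of 1] hnat_pos[OF k]
  proof eventually_elim
    case (elim d)
    have "hsum (f d) \<le> hsum (range_of d)" using elim finite_range by (intro hsum_mono) auto
    also have "\<dots> \<le> 1 + ln (real (nat_part (d M)))"
      unfolding range_of_def using elim by (intro hsum_le_ln) auto
    finally show ?case using elim hsum_nonneg[of "f d"] by (simp add: divide_le_eq)
  qed
  show ?thesis unfolding mass_def
    by (rule st_approx[OF hlogsum_value[OF assms(1) fin M] bound assms(3)])
qed

lemma mass_le:
  assumes "finitary f" "\<forall>\<^sub>F d in gen. f d \<subseteq> range_of d"
    and "\<forall>\<^sub>F d in gen. hsum (f d) \<le> q * ln (real (nat_part (d M)))"
  shows "mass f \<le> q"
proof (rule field_le_epsilon)
  fix e :: real assume "0 < e"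
  have "\<forall>\<^sub>F d in gen. mass f \<le> q + e"
    using mass_approx[OF assms(1,2) \<open>0 < e\<close>] assms(3) ln_large[of 1]
  proof eventually_elim
    case (elim d)
    then have "hsum (f d) / ln (real (nat_part (d M))) \<le> q" by (simp add: divide_le_eq)
    then show ?case using elim(1) by linarith
  qed
  then show "mass f \<le> q + e" by simp
qed

lemma mass_less:
  assumes "finitary f" "\<forall>\<^sub>F d in gen. f d \<subseteq> range_of d" "mass f < q"
  shows "\<forall>\<^sub>F d in gen. hsum (f d) < q * ln (real (nat_part (d M)))"
proof -
  have "0 < q - mass f" using assms(3) by simp
  from mass_approx[OF assms(1,2) this] ln_large[of 1] show ?thesis
  proof eventually_elim
    case (elim d)
    then have "hsum (f d) / ln (real (nat_part (d M))) < q" by linarith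
    then show ?case using elim(2) by (simp add: divide_less_eq)
  qed
qed

lemma mass_nonneg:
  assumes "finitary f" "\<forall>\<^sub>F d in gen. f d \<subseteq> range_of d"
  shows "0 \<le> mass f"
proof (rule field_le_epsilon)
  fix e :: real assume "0 < e"
  have "\<forall>\<^sub>F d in gen. 0 \<le> mass f + e"
    using mass_approx[OF assms(1,2) \<open>0 < e\<close>] ln_large[of 1]
  proof eventually_elim
    case (elim d)
    have "0 \<le> hsum (f d) / ln (real (nat_part (d M)))" using elim hsum_nonneg by simp
    then show ?case using elim(1) by linarith
  qed
  then show "0 \<le> mass f + e" by simp
qed

lemma mass_add:
  assumes "finitary f" "\<forall>\<^sub>F d in gen. f d \<subseteq> range_of d" "finitary g" "\<forall>\<^sub>F d in gen. g d \<subseteq> range_of d"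
    and "\<forall>\<^sub>F d in gen. f d \<inter> g d = {}"
  shows "mass (\<lambda>d. f d \<union> g d) = mass f + mass g"
proof -
  have fin: "finitary (\<lambda>d. f d \<union> g d)" by (rule finitary_comp2[OF assms(1,3)])
  have sub: "\<forall>\<^sub>F d in gen. f d \<union> g d \<subseteq> range_of d" using assms(2,4) by eventually_elim simp
  have "\<bar>mass (\<lambda>d. f d \<union> g d) - (mass f + mass g)\<bar> \<le> e" if "0 < e" for e
  proof -
    have e: "0 < e / 3" using that by simp
    have "\<forall>\<^sub>F d in gen. \<bar>mass (\<lambda>d. f d \<union> g d) - (mass f + mass g)\<bar> \<le> e"
      using mass_approx[OF assms(1,2) e] mass_approx[OF assms(3,4) e] mass_approx[OF fin sub e]
        assms(2,4,5)
    proof eventually_elim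
      case (elim d)
      have "hsum (f d \<union> g d) = hsum (f d) + hsum (g d)"
        using elim finite_range finite_subset by (intro hsum_Un_disjoint) blast+
      then have "hsum (f d \<union> g d) / ln (real (nat_part (d M)))
        = hsum (f d) / ln (real (nat_part (d M))) + hsum (g d) / ln (real (nat_part (d M)))"
        by (simp add: add_divide_distrib)
      then show ?case using elim(1-3) by linarith
    qed
    then show ?thesis by simp
  qed
  then have "\<bar>mass (\<lambda>d. f d \<union> g d) - (mass f + mass g)\<bar> \<le> 0" by (rule field_le_epsilon) simp
  then show ?thesis by simp
qed

definition internals :: "'h set set" where
  "internals = {C. internal star C \<and> C \<subseteq> hseg k (htimes M k)}"

lemma internalsE:
  assumes "C \<in> internals"
  obtains f where "finitary f" "\<forall>\<^sub>F d in gen. f d \<subseteq> range_of d" "C = iset f"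
proof -
  have "C \<subseteq> hnat" using assms unfolding internals_def hseg_def by blast
  then obtain f where f: "finitary f" "C = iset f"
    using internal_is_iset assms unfolding internals_def by blast
  have "iset f \<subseteq> iset range_of" using f assms hseg_iset unfolding internals_def by simp
  then have "\<forall>\<^sub>F d in gen. f d \<subseteq> range_of d" by (rule iset_subsetD[OF f(1) finitary_range])
  then show ?thesis using that f by blast
qed

lemma internalsI:
  assumes "finitary f" "\<forall>\<^sub>F d in gen. f d \<subseteq> range_of d"
  shows "iset f \<in> internals"
  unfolding internals_def using internal_iset[OF assms(1)] iset_mono[OF assms(2)] hseg_iset by simp

lemma ring_internals: "ring_of_sets (hseg k (htimes M k)) internals"
proof (rule ring_of_setsI)
  show "internals \<subseteq> Pow (hseg k (htimes M k))" unfolding internals_def by blast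
  show "{} \<in> internals"
    using internalsI[of "\<lambda>d. {}"] iset_empty by (simp add: finitaryI[of "{}"])
  fix C D assume "C \<in> internals" "D \<in> internals"
  then obtain f g where f: "finitary f" "\<forall>\<^sub>F d in gen. f d \<subseteq> range_of d" "C = iset f"
    and g: "finitary g" "\<forall>\<^sub>F d in gen. g d \<subseteq> range_of d" "D = iset g"
    by (metis internalsE)
  have "iset (\<lambda>d. f d \<union> g d) \<in> internals"
  proof (rule internalsI)
    show "\<forall>\<^sub>F d in gen. f d \<union> g d \<subseteq> range_of d" using f(2) g(2) by eventually_elim simp
  qed (rule finitary_comp2[OF f(1) g(1)])
  then show "C \<union> D \<in> internals" using iset_Un[OF f(1) g(1)] f g by simp
  have fin: "finitary (\<lambda>d. f d - g d)" by (rule finitary_comp2[OF f(1) g(1)])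
  have "iset (\<lambda>d. f d - g d) \<in> internals"
  proof (rule internalsI[OF fin])
    show "\<forall>\<^sub>F d in gen. f d - g d \<subseteq> range_of d" using f(2) by eventually_elim blast
  qed
  moreover have "iset (\<lambda>d. f d - g d) = C - D"
  proof -
    have "iset (\<lambda>d. f d - g d) \<inter> iset g = {}"
      unfolding iset_Int[symmetric] using iset_cong[of "\<lambda>d. (f d - g d) \<inter> g d" "\<lambda>d. {}"] iset_empty
      by (simp add: Int_commute)
    moreover have "iset (\<lambda>d. f d - g d) \<union> iset g = iset f \<union> iset g"
      unfolding iset_Un[OF fin g(1), symmetric] iset_Un[OF f(1) g(1), symmetric] by simp
    ultimately show ?thesis using f g by blast
  qed
  ultimately show "C - D \<in> internals" by simp
qed

lemma decseq_internals_empty: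
  assumes "range C \<subseteq> internals" "decseq C" "(\<Inter>i. C i) = {}"
  obtains n where "C n = {}"
proof -
  have "\<exists>n. (\<Inter>i\<le>n. C i) = {}"
    using countable_saturation[of C] assms(1,3) unfolding internals_def by blast
  then obtain n where "(\<Inter>i\<le>n. C i) = {}" by blast
  moreover have "C n \<subseteq> (\<Inter>i\<le>n. C i)" using assms(2) by (auto simp: decseq_def)
  ultimately show ?thesis using that by blast
qed

text \<open>Countable additivity comes from saturation: a decreasing sequence of internal sets with
  empty intersection is empty from some index on, so continuity at the empty set is the convergence
  of an eventually vanishing sequence.\<close>

lemma loeb_caratheodory:
  "\<exists>\<mu>. (\<forall>C\<in>internals. \<mu> C = ennreal (st (hlogsum C M))) \<and>
    measure_space (hseg k (htimes M k)) (sigma_sets (hseg k (htimes M k)) internals) \<mu>"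
proof (rule ring_of_sets.caratheodory_empty_continuous[OF ring_internals])
  have empty: "st (hlogsum {} M) = 0"
  proof -
    have e: "finitary (\<lambda>d::'h \<Rightarrow> std. {} :: nat set)" by (rule finitaryI[of "{}"]) simp_all
    have "mass (\<lambda>d. {}) \<le> 0" by (rule mass_le[OF e]) (simp_all add: hsum_def)
    moreover have "0 \<le> mass (\<lambda>d. {})" by (rule mass_nonneg[OF e]) simp
    ultimately show ?thesis by (simp add: mass_def iset_empty)
  qed
  then show "positive internals (\<lambda>C. ennreal (st (hlogsum C M)))" by (simp add: positive_def)
  show "additive internals (\<lambda>C. ennreal (st (hlogsum C M)))"
    unfolding additive_def
  proof (intro ballI impI)
    fix C D assume "C \<in> internals" "D \<in> internals" and disj: "C \<inter> D = {}"
    then obtain f g where f: "finitary f" "\<forall>\<^sub>F d in gen. f d \<subseteq> range_of d" "C = iset f"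
      and g: "finitary g" "\<forall>\<^sub>F d in gen. g d \<subseteq> range_of d" "D = iset g"
      by (metis internalsE)
    have "iset (\<lambda>d. f d \<inter> g d) = iset (\<lambda>d. {})" using disj f g by (simp add: iset_Int iset_empty)
    then have "\<forall>\<^sub>F d in gen. f d \<inter> g d = {}"
      by (rule iset_eqD[OF finitary_comp2[OF f(1) g(1)] finitaryI[of "{}"], rotated 2]) simp_all
    then have "mass (\<lambda>d. f d \<union> g d) = mass f + mass g" by (rule mass_add[OF f(1,2) g(1,2)])
    then have "st (hlogsum (C \<union> D) M) = st (hlogsum C M) + st (hlogsum D M)"
      using iset_Un[OF f(1) g(1)] f(3) g(3) by (simp add: mass_def)
    then show "ennreal (st (hlogsum (C \<union> D) M)) = ennreal (st (hlogsum C M)) + ennreal (st (hlogsum D M))"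
      using mass_nonneg[OF f(1,2)] mass_nonneg[OF g(1,2)] f(3) g(3) by (simp add: mass_def ennreal_plus)
  qed
  show "ennreal (st (hlogsum C M)) \<noteq> \<infinity>" for C by simp
  fix C :: "nat \<Rightarrow> 'h set"
  assume C: "range C \<subseteq> internals" "decseq C" "(\<Inter>i. C i) = {}"
  obtain n where n: "C n = {}" by (rule decseq_internals_empty[OF C])
  have "\<forall>\<^sub>F i in sequentially. ennreal (st (hlogsum (C i) M)) = 0"
    unfolding eventually_sequentially
  proof (intro exI[of _ n] allI impI)
    fix i assume "n \<le> i"
    then have "C i = {}" using C(2) n by (auto simp: decseq_def)
    then show "ennreal (st (hlogsum (C i) M)) = 0" using empty by simp
  qed
  then show "(\<lambda>i. ennreal (st (hlogsum (C i) M))) \<longlonglongrightarrow> 0" by (rule tendsto_eventually)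
qed

abbreviation internal_measure :: "'h measure" where
  "internal_measure \<equiv> extend_measure (hseg k (htimes M k)) internals (\<lambda>C. C) (\<lambda>C. ennreal (st (hlogsum C M)))"

lemma internals_Pow: "(\<lambda>C. C) ` internals \<subseteq> Pow (hseg k (htimes M k))"
  unfolding internals_def by blast

lemma loeb_eq: "loeb k M = completion internal_measure"
  unfolding loeb_def internals_def ..

lemma space_loeb: "space (loeb k M) = hseg k (htimes M k)"
  unfolding loeb_eq using space_extend_measure[OF internals_Pow] by simp

lemma iset_loeb:
  assumes "finitary f" "\<forall>\<^sub>F d in gen. f d \<subseteq> range_of d"
  shows "iset f \<in> sets (loeb k M)" "emeasure (loeb k M) (iset f) = ennreal (mass f)"
    "measure (loeb k M) (iset f) = mass f" "iset f \<in> fmeasurable (loeb k M)"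
proof -
  have I: "iset f \<in> internals" by (rule internalsI[OF assms])
  have sets: "sets internal_measure = sigma_sets (hseg k (htimes M k)) internals"
    using sets_extend_measure[OF internals_Pow] by simp
  then have s: "iset f \<in> sets internal_measure" using I by (simp add: sigma_sets.Basic)
  then show s': "iset f \<in> sets (loeb k M)" unfolding loeb_eq by simp
  obtain \<mu> where \<mu>: "\<And>C. C \<in> internals \<Longrightarrow> \<mu> C = ennreal (st (hlogsum C M))"
    "measure_space (hseg k (htimes M k)) (sigma_sets (hseg k (htimes M k)) internals) \<mu>"
    using loeb_caratheodory by blast
  have "emeasure internal_measure (iset f) = ennreal (st (hlogsum (iset f) M))"
    by (rule emeasure_extend_measure[OF refl, where \<mu>' = \<mu>])
      (use \<mu> I internals_Pow sets in \<open>auto simp: measure_space_def\<close>)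
  then show e: "emeasure (loeb k M) (iset f) = ennreal (mass f)"
    unfolding loeb_eq using s by (simp add: mass_def)
  then show "measure (loeb k M) (iset f) = mass f"
    using mass_nonneg[OF assms] by (simp add: measure_def)
  show "iset f \<in> fmeasurable (loeb k M)" using s' e by (simp add: fmeasurable_def)
qed

text \<open>The total harmonic sum exceeds \<open>ln M\<close> by at most 1, which is below
  \<open>e * ln M\<close> for every standard \<open>e\<close> because \<open>M\<close> is
  infinite.\<close>

lemma loeb_space_le: "emeasure (loeb k M) (hseg k (htimes M k)) \<le> 1"
proof -
  have "mass range_of \<le> 1 + e" if "0 < e" for e
  proof (rule mass_le[OF finitary_range])
    show "\<forall>\<^sub>F d in gen. hsum (range_of d) \<le> (1 + e) * ln (real (nat_part (d M)))"
      using ln_large[of "1 / e"] large[of 1] hnat_pos[OF k]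
    proof eventually_elim
      case (elim d)
      have "hsum (range_of d) \<le> 1 + ln (real (nat_part (d M)))"
        unfolding range_of_def using elim by (intro hsum_le_ln) auto
      moreover have "1 \<le> e * ln (real (nat_part (d M)))"
        using elim(1) that by (simp add: field_simps)
      ultimately show ?case by (simp add: algebra_simps)
    qed
  qed simp
  then have "mass range_of \<le> 1" by (rule field_le_epsilon) simp
  then show ?thesis using iset_loeb(2)[OF finitary_range] hseg_iset by (simp add: ennreal_le_1)
qed

lemma loeb_sandwich:
  assumes "\<And>e. 0 < e \<Longrightarrow> \<exists>f g. finitary f \<and> finitary g \<and> (\<forall>\<^sub>F d in gen. f d \<subseteq> range_of d) \<and>
    (\<forall>\<^sub>F d in gen. g d \<subseteq> range_of d) \<and> iset f \<subseteq> S \<and> S \<subseteq> iset g \<and> \<bar>mass f - mass g\<bar> < e"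
  shows "S \<in> sets (loeb k M)"
proof -
  have "S \<in> fmeasurable (loeb k M)"
    unfolding loeb_eq completion.fmeasurable_inner_outer
  proof (intro allI impI)
    fix e :: real assume "0 < e"
    then obtain f g where fg: "finitary f" "finitary g" "\<forall>\<^sub>F d in gen. f d \<subseteq> range_of d"
      "\<forall>\<^sub>F d in gen. g d \<subseteq> range_of d" "iset f \<subseteq> S" "S \<subseteq> iset g" "\<bar>mass f - mass g\<bar> < e"
      using assms by blast
    show "\<exists>T\<in>fmeasurable (completion internal_measure). \<exists>U\<in>fmeasurable (completion internal_measure).
        T \<subseteq> S \<and> S \<subseteq> U \<and> \<bar>measure (completion internal_measure) T - measure (completion internal_measure) U\<bar> < e"
      unfolding loeb_eq[symmetric]
      using iset_loeb(3,4)[OF fg(1,3)] iset_loeb(3,4)[OF fg(2,4)] fg(5-7)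
      by (intro bexI[of _ "iset f"] bexI[of _ "iset g"]) simp_all
  qed
  then show ?thesis by (rule fmeasurableD)
qed

lemma loeb_null:
  assumes "\<And>e. 0 < e \<Longrightarrow> \<exists>f. finitary f \<and> (\<forall>\<^sub>F d in gen. f d \<subseteq> range_of d) \<and> S \<subseteq> iset f \<and> mass f \<le> e"
  shows "S \<in> null_sets (loeb k M)"
  unfolding loeb_eq completion.null_sets_outer_le
proof (intro allI impI)
  fix e :: real assume "0 < e"
  then obtain f where f: "finitary f" "\<forall>\<^sub>F d in gen. f d \<subseteq> range_of d" "S \<subseteq> iset f" "mass f \<le> e"
    using assms by blast
  then show "\<exists>T\<in>fmeasurable (completion internal_measure). S \<subseteq> T \<and> measure (completion internal_measure) T \<le> e"
    unfolding loeb_eq[symmetric] using iset_loeb(3,4)[OF f(1,2)] by (intro bexI[of _ "iset f"]) simp_all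
qed

text \<open>\<open>measure_of\<close> is known to have the intended sets and values once these are
  shown to form a sigma-algebra with a countably additive function. Both properties are pulled back
  from the Loeb measure along \<open>cls V\<close>.\<close>

lemma cls_measure_char:
  fixes V :: "'h set"
  defines "\<Omega> \<equiv> cls V ` hseg k (htimes M k)"
  defines "\<A> \<equiv> {E. E \<subseteq> cls V ` hseg k (htimes M k) \<and> cls V -` E \<inter> hseg k (htimes M k) \<in> sets (loeb k M)}"
  shows space_cls_measure: "space (cls_measure k M V) = \<Omega>"
    and sets_cls_measure: "sets (cls_measure k M V) = \<A>"
    and emeasure_cls_measure: "E \<in> \<A> \<Longrightarrow>
      emeasure (cls_measure k M V) E = emeasure (loeb k M) (cls V -` E \<inter> hseg k (htimes M k))"
proof -
  let ?H = "hseg k (htimes M k)"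
  have sa: "sigma_algebra \<Omega> \<A>"
    unfolding sigma_algebra_iff2
  proof (intro conjI ballI allI impI)
    show "\<A> \<subseteq> Pow \<Omega>" unfolding \<A>_def \<Omega>_def by blast
    show "{} \<in> \<A>" unfolding \<A>_def by simp
    fix E assume E: "E \<in> \<A>"
    have "cls V -` (\<Omega> - E) \<inter> ?H = space (loeb k M) - (cls V -` E \<inter> ?H)"
      unfolding space_loeb \<Omega>_def by blast
    then show "\<Omega> - E \<in> \<A>" using E unfolding \<A>_def \<Omega>_def by auto
  next
    fix E :: "nat \<Rightarrow> 'h set set" assume E: "range E \<subseteq> \<A>"
    have "cls V -` (\<Union>i. E i) \<inter> ?H = (\<Union>i. cls V -` E i \<inter> ?H)" by blast
    moreover have "(\<Union>i. cls V -` E i \<inter> ?H) \<in> sets (loeb k M)"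
      using E unfolding \<A>_def by (intro sets.countable_UN) blast
    ultimately show "(\<Union>i. E i) \<in> \<A>" using E unfolding \<A>_def by auto
  qed
  have eq: "cls_measure k M V = measure_of \<Omega> \<A> (\<lambda>E. emeasure (loeb k M) (cls V -` E \<inter> ?H))"
    unfolding cls_measure_def \<Omega>_def \<A>_def ..
  have Pow: "\<A> \<subseteq> Pow \<Omega>" unfolding \<A>_def \<Omega>_def by blast
  show "space (cls_measure k M V) = \<Omega>" unfolding eq using space_measure_of[OF Pow] .
  show "sets (cls_measure k M V) = \<A>"
    unfolding eq using sigma_algebra.sets_measure_of_eq[OF sa] by simp
  have pos: "positive \<A> (\<lambda>E. emeasure (loeb k M) (cls V -` E \<inter> ?H))" by (simp add: positive_def)
  have ca: "countably_additive \<A> (\<lambda>E. emeasure (loeb k M) (cls V -` E \<inter> ?H))"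
    unfolding countably_additive_def
  proof (intro allI impI)
    fix E :: "nat \<Rightarrow> 'h set set" assume E: "range E \<subseteq> \<A>" "disjoint_family E"
    have "(\<Sum>i. emeasure (loeb k M) (cls V -` E i \<inter> ?H)) = emeasure (loeb k M) (\<Union>i. cls V -` E i \<inter> ?H)"
    proof (rule suminf_emeasure)
      show "range (\<lambda>i. cls V -` E i \<inter> ?H) \<subseteq> sets (loeb k M)" using E(1) unfolding \<A>_def by blast
      show "disjoint_family (\<lambda>i. cls V -` E i \<inter> ?H)" using E(2) unfolding disjoint_family_on_def by blast
    qed
    also have "(\<Union>i. cls V -` E i \<inter> ?H) = cls V -` (\<Union>i. E i) \<inter> ?H" by blast
    finally show "(\<Sum>i. emeasure (loeb k M) (cls V -` E i \<inter> ?H)) = emeasure (loeb k M) (cls V -` (\<Union>i. E i) \<inter> ?H)" .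
  qed
  show "emeasure (cls_measure k M V) E = emeasure (loeb k M) (cls V -` E \<inter> ?H)" if "E \<in> \<A>"
    unfolding eq by (rule emeasure_measure_of_sigma[OF sa pos ca that])
qed

end

section \<open>Density points\<close>

context nonstd_cut begin

lemma loeb_interval_above:
  assumes "b \<in> hnat" "r \<in> hnat - V"
  shows "loeb_interval star b r"
  by unfold_locales (use assms above_cut_large[OF assms(2)] in auto)

text \<open>Halving cannot lead into \<open>V\<close>, because \<open>s \<le> 4 * (s div 2)\<close>
  for these values and \<open>V\<close> absorbs the factor 4. It follows that the infima in the
  densities range over nonempty sets.\<close>

lemma above_cut_smaller:
  assumes "s \<in> hnat - V"
  obtains r where "r \<in> hnat - V" "hless r s"
proof -
  let ?t = "emb (SNat 2)"
  let ?r = "hdiv s ?t"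
  have s: "s \<in> hnat" and t: "?t \<in> hnat" using assms emb_hnat by auto
  have "\<forall>\<^sub>F d in gen. nat_part (d ?t) \<le> nat_part (d s)"
    using above_cut_large[OF assms, of 2] emb_nat[of 2] by eventually_elim simp
  then have r: "?r \<in> hnat" using hdiv_hnat[OF s t] hle_iff[OF t s] by blast
  have rv: "\<forall>\<^sub>F d in gen. nat_part (d ?r) = nat_part (d s) div 2"
    using hdiv_nat[OF s t] emb_nat[of 2] by eventually_elim simp
  have "?r \<notin> V"
  proof
    assume rV: "?r \<in> V"
    let ?q = "htimes ?t (htimes ?t ?r)"
    have qV: "?q \<in> V" using cut_times two_in_cut rV by blast
    have "\<forall>\<^sub>F d in gen. nat_part (d s) \<le> nat_part (d ?q)"
      using htimes_nat[OF t htimes_hnat[OF t r]] htimes_nat[OF t r] emb_nat[of 2] rv hnat_pos[OF r]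
      by eventually_elim simp
    then have "s \<in> V" by (rule cut_down[OF qV s])
    then show False using assms by simp
  qed
  moreover have "\<forall>\<^sub>F d in gen. nat_part (d ?r) < nat_part (d s)"
    using rv hnat_pos[OF s] by eventually_elim simp
  then have "hless ?r s" using hless_iff[OF r s] by blast
  ultimately show ?thesis using that r by blast
qed

text \<open>A class between those of \<open>l\<close> and \<open>u\<close> may have been given by a
  point outside the interval, but then it is the class of an endpoint.\<close>

lemma cls_vseg_hseg:
  assumes "l \<in> hnat" "u \<in> hnat" "hle l u"
  shows "vseg V (cls V l) (cls V u) \<subseteq> cls V ` hseg l u"
    and "c \<in> hseg l u \<Longrightarrow> cls V c \<in> vseg V (cls V l) (cls V u)"
proof -
  have lu: "l \<in> hseg l u" "u \<in> hseg l u"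
    using assms hle_iff[OF assms(1,1)] hle_iff[OF assms(2,2)] by (auto simp: hseg_def)
  show "vseg V (cls V l) (cls V u) \<subseteq> cls V ` hseg l u"
  proof
    fix e assume "e \<in> vseg V (cls V l) (cls V u)"
    then obtain c where c: "c \<in> hnat" "e = cls V c" "vle V (cls V l) (cls V c)" "vle V (cls V c) (cls V u)"
      unfolding vseg_def by blast
    then have *: "hle l c \<or> veq V l c" "hle c u \<or> veq V c u" using vle_cls_iff assms by blast+
    consider "c \<in> hseg l u" | "veq V l c" | "veq V c u"
      using * c(1) unfolding hseg_def by blast
    then show "e \<in> cls V ` hseg l u"
    proof cases
      case 1
      then show ?thesis using c by simp
    next
      case 2
      then have "e = cls V l" using c cls_eq_iff[of l c] assms by simp
      then show ?thesis using lu by simp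
    next
      case 3
      then have "e = cls V u" using c cls_eq_iff[of c u] assms by simp
      then show ?thesis using lu by simp
    qed
  qed
  assume "c \<in> hseg l u"
  then have "c \<in> hnat" "hle l c" "hle c u" by (auto simp: hseg_def)
  then show "cls V c \<in> vseg V (cls V l) (cls V u)"
    unfolding vseg_def using vle_cls_iff assms by blast
qed

end

section \<open>The preimage of the image of an internal set\<close>

locale internal_cut = nonstd_cut star V N for star :: "std list set \<Rightarrow> 'h list set" and V N +
  fixes k :: 'h and \<alpha> :: "('h \<Rightarrow> std) \<Rightarrow> nat set"
  assumes k_hnat: "k \<in> hnat" and \<alpha>: "finitary \<alpha>"
    and \<alpha>_range: "\<forall>\<^sub>F d in gen. \<alpha> d \<subseteq> {nat_part (d k)..nat_part (d N) * nat_part (d k)}"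
begin

sublocale loeb_interval star k N
  using loeb_interval_above[OF k_hnat above] .

definition saturation :: "'h set" where
  "saturation = {y \<in> hnat. \<exists>a\<in>iset \<alpha>. veq V a y}"

lemma \<alpha>_finite: "\<forall>\<^sub>F d in gen. finite (\<alpha> d)"
  using \<alpha>_range by eventually_elim (rule finite_subset, auto)

lemma iset_\<alpha>_hnat: "iset \<alpha> \<subseteq> hnat"
  using iset_mono[of \<alpha> range_of] \<alpha>_range hseg_iset by (auto simp: hseg_def range_of_def)

lemma cls_in_image_iff:
  assumes "y \<in> hnat"
  shows "cls V y \<in> cls V ` iset \<alpha> \<longleftrightarrow> y \<in> saturation"
proof
  assume "cls V y \<in> cls V ` iset \<alpha>"
  then obtain a where a: "a \<in> iset \<alpha>" "cls V y = cls V a" by blast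
  then have "veq V a y" using cls_eq_iff[of a y] iset_\<alpha>_hnat assms by auto
  then show "y \<in> saturation" using a assms by (auto simp: saturation_def)
next
  assume "y \<in> saturation"
  then obtain a where a: "a \<in> iset \<alpha>" "veq V a y" by (auto simp: saturation_def)
  then have "cls V a = cls V y" using cls_eq_iff[of a y] iset_\<alpha>_hnat assms by auto
  then show "cls V y \<in> cls V ` iset \<alpha>" using a by (metis imageI)
qed

text \<open>Membership in the neighbourhood yields, for each \<open>d\<close>, some point of
  \<open>\<alpha> d\<close> within ratio \<open>v\<close>; \<open>gen_ex\<close> makes these the
  values of one hypernatural, and that point is equivalent to \<open>x\<close> because
  \<open>v\<close> is in \<open>V\<close>.\<close>

lemma nbhd_below:
  assumes "v \<in> V"
  shows "iset (\<lambda>d. nbhd (\<alpha> d) (nat_part (d v))) \<subseteq> saturation"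
proof
  fix x assume "x \<in> iset (\<lambda>d. nbhd (\<alpha> d) (nat_part (d v)))"
  then have x: "\<forall>\<^sub>F d in gen. d x = SNat (nat_part (d x)) \<and> nat_part (d x) \<in> nbhd (\<alpha> d) (nat_part (d v))"
    by (simp add: iset_def)
  then have xh: "x \<in> hnat" unfolding hnat_iff by eventually_elim (simp add: nbhd_def)
  let ?Q = "\<lambda>d z. z = SNat (nat_part z) \<and> nat_part z \<in> \<alpha> d \<and>
      nat_part (d x) \<le> nat_part (d v) * nat_part z \<and> nat_part z \<le> nat_part (d v) * nat_part (d x)"
  have "\<forall>\<^sub>F d in gen. \<exists>z. ?Q d z"
    using x
  proof eventually_elim
    case (elim d)
    then obtain n where "n \<in> \<alpha> d" "nat_part (d x) \<le> nat_part (d v) * n" "n \<le> nat_part (d v) * nat_part (d x)"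
      unfolding nbhd_def by blast
    then show ?case by (intro exI[of _ "SNat n"]) simp
  qed
  moreover have "finitary ?Q"
    by (rule finitary_comp3[OF \<alpha> finitary_coord[of x] finitary_coord[of v],
      of "\<lambda>S u w z. z = SNat (nat_part z) \<and> nat_part z \<in> S \<and>
      nat_part u \<le> nat_part w * nat_part z \<and> nat_part z \<le> nat_part w * nat_part u"])
  ultimately obtain a where a: "\<forall>\<^sub>F d in gen. ?Q d (d a)" using gen_ex[of ?Q] by blast
  have aA: "a \<in> iset \<alpha>" unfolding iset_def mem_Collect_eq using a by eventually_elim simp
  have "\<forall>\<^sub>F d in gen. nat_part (d a) \<le> nat_part (d v) * nat_part (d x) \<and> nat_part (d x) \<le> nat_part (d v) * nat_part (d a)"
    using a by eventually_elim simp
  then have "veq V a x" using veq_iff[of a x] aA iset_\<alpha>_hnat xh assms by blast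
  then show "x \<in> saturation" using aA xh by (auto simp: saturation_def)
qed

lemma nbhd_above:
  assumes "s \<in> hnat - V"
  shows "saturation \<subseteq> iset (\<lambda>d. nbhd (\<alpha> d) (nat_part (d s)))"
proof
  fix y assume "y \<in> saturation"
  then obtain a where a: "y \<in> hnat" "a \<in> iset \<alpha>" "veq V a y" by (auto simp: saturation_def)
  then obtain u where u: "u \<in> V" "\<forall>\<^sub>F d in gen. nat_part (d a) \<le> nat_part (d u) * nat_part (d y) \<and>
    nat_part (d y) \<le> nat_part (d u) * nat_part (d a)" using veq_iff[of a y] iset_\<alpha>_hnat by blast
  have "\<forall>\<^sub>F d in gen. d a = SNat (nat_part (d a)) \<and> nat_part (d a) \<in> \<alpha> d" using a(2) by (simp add: iset_def)
  then show "y \<in> iset (\<lambda>d. nbhd (\<alpha> d) (nat_part (d s)))"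
    unfolding iset_def mem_Collect_eq
    using u(2) cut_less[OF u(1) assms] hnat_value[OF a(1)] hnat_pos[OF a(1)]
  proof eventually_elim
    case (elim d)
    have "nat_part (d a) \<le> nat_part (d s) * nat_part (d y)"
      using elim by (meson le_trans less_imp_le mult_le_mono1)
    moreover have "nat_part (d y) \<le> nat_part (d s) * nat_part (d a)"
      using elim by (meson le_trans less_imp_le mult_le_mono1)
    ultimately show ?case using elim unfolding nbhd_def by blast
  qed
qed

definition dens :: "'h \<Rightarrow> 'h \<Rightarrow> ennreal" where
  "dens b r = emeasure (loeb b r) (saturation \<inter> hseg b (htimes r b))"

text \<open>On a fixed interval the inner and the outer neighbourhoods have masses that
  \<open>cut_gap\<close> brings together, so internal sets approximate the saturation from both
  sides.\<close>

lemma saturation_measurable: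
  assumes "b \<in> hnat" "r \<in> hnat - V"
  shows "saturation \<inter> hseg b (htimes r b) \<in> sets (loeb b r)"
proof -
  interpret L: loeb_interval star b r by (rule loeb_interval_above[OF assms])
  define F where "F d n = hsum (nbhd (\<alpha> d) n \<inter> L.range_of d) / ln (real (nat_part (d r)))" for d n
  have finF: "finitary F"
    unfolding F_def[abs_def]
    by (rule finitary_comp3[OF \<alpha> L.finitary_range finitary_coord[of r],
      of "\<lambda>S R u n. hsum (nbhd S n \<inter> R) / ln (real (nat_part u))"])
  have F0: "0 \<le> F d n" for d n
    unfolding F_def by (intro divide_nonneg_nonneg hsum_nonneg ln_of_nat_nonneg)
  have F2: "\<forall>\<^sub>F d in gen. \<forall>n. 1 \<le> n \<and> n \<le> nat_part (d N) \<longrightarrow> F d n \<le> 2"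
    using L.ln_large[of 1] L.large[of 1] hnat_pos[OF assms(1)]
  proof eventually_elim
    case (elim d)
    have "F d n \<le> 2" for n
    proof -
      have "hsum (nbhd (\<alpha> d) n \<inter> L.range_of d) \<le> hsum (L.range_of d)"
        by (rule hsum_mono[OF L.finite_range]) simp
      also have "\<dots> \<le> 1 + ln (real (nat_part (d r)))"
        unfolding L.range_of_def using elim by (intro hsum_le_ln) auto
      finally show ?thesis unfolding F_def using elim by (simp add: divide_le_eq)
    qed
    then show ?case by blast
  qed
  show ?thesis
  proof (rule L.loeb_sandwich)
    fix e :: real assume e: "0 < e"
    then have "0 < e / 2" by simp
    from cut_gap[OF finF F2 F0 this] obtain v s where vs: "v \<in> V" "s \<in> hnat - V"
      "\<forall>\<^sub>F d in gen. F d (nat_part (d s)) < F d (nat_part (d v)) + e / 2" by blast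
    define f where "f x d = nbhd (\<alpha> d) (nat_part (d x)) \<inter> L.range_of d" for x d
    have fin: "finitary (f x)" for x
      unfolding f_def[abs_def]
      by (rule finitary_comp3[OF \<alpha> L.finitary_range finitary_coord[of x],
        of "\<lambda>S R u. nbhd S (nat_part u) \<inter> R"])
    have sub: "\<forall>\<^sub>F d in gen. f x d \<subseteq> L.range_of d" for x by (simp add: f_def)
    have isf: "iset (f x) = iset (\<lambda>d. nbhd (\<alpha> d) (nat_part (d x))) \<inter> hseg b (htimes r b)" for x
      unfolding f_def[abs_def] iset_Int L.hseg_iset ..
    \<comment> \<open>The two standard parts cost \<open>e / 8\<close> each and the gap costs
      \<open>e / 2\<close>, which leaves the difference of the masses below
      \<open>e\<close>.\<close>
    have e8: "0 < e / 8" using e by simp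
    have "\<forall>\<^sub>F d in gen. \<bar>L.mass (f v) - L.mass (f s)\<bar> < e"
      using L.mass_approx[OF fin sub e8, of v] L.mass_approx[OF fin sub e8, of s] vs(3)
        cut_less[OF vs(1,2)] L.ln_large[of 1]
    proof eventually_elim
      case (elim d)
      have "hsum (f v d) \<le> hsum (f s d)"
        unfolding f_def using nbhd_mono[of "nat_part (d v)" "nat_part (d s)" "\<alpha> d"] elim L.finite_range
        by (intro hsum_mono) auto
      then have "hsum (f v d) / ln (real (nat_part (d r))) \<le> hsum (f s d) / ln (real (nat_part (d r)))"
        using elim by (intro divide_right_mono) auto
      moreover have "hsum (f s d) / ln (real (nat_part (d r))) < hsum (f v d) / ln (real (nat_part (d r))) + e / 2"
        using elim by (simp add: F_def f_def)
      ultimately show ?case using elim(1,2) e by linarith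
    qed
    then have "\<bar>L.mass (f v) - L.mass (f s)\<bar> < e" by simp
    then show "\<exists>f g. finitary f \<and> finitary g \<and> (\<forall>\<^sub>F d in gen. f d \<subseteq> L.range_of d) \<and>
      (\<forall>\<^sub>F d in gen. g d \<subseteq> L.range_of d) \<and> iset f \<subseteq> saturation \<inter> hseg b (htimes r b) \<and>
      saturation \<inter> hseg b (htimes r b) \<subseteq> iset g \<and> \<bar>L.mass f - L.mass g\<bar> < e"
      using fin sub isf nbhd_below[OF vs(1)] nbhd_above[OF vs(2)]
      by (intro exI[of _ "f v"] exI[of _ "f s"]) auto
  qed
qed

lemma dens_le_1:
  assumes "b \<in> hnat" "r \<in> hnat - V"
  shows "dens b r \<le> 1"
proof -
  interpret L: loeb_interval star b r by (rule loeb_interval_above[OF assms])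
  have "dens b r \<le> emeasure (loeb b r) (hseg b (htimes r b))"
    unfolding dens_def using sets.top[of "loeb b r"] L.space_loeb by (intro emeasure_mono) auto
  then show ?thesis using L.loeb_space_le by (rule order_trans)
qed

lemma cls_measure_vseg:
  assumes "b \<in> hnat" "r \<in> hnat - V"
  shows "emeasure (cls_measure b r V) (cls V ` iset \<alpha> \<inter> vseg V (cls V b) (cls V (htimes r b))) = dens b r"
proof -
  interpret L: loeb_interval star b r by (rule loeb_interval_above[OF assms])
  let ?E = "cls V ` iset \<alpha> \<inter> vseg V (cls V b) (cls V (htimes r b))"
  let ?H = "hseg b (htimes r b)"
  have r: "r \<in> hnat" using assms by simp
  have rb: "htimes r b \<in> hnat" by (rule htimes_hnat[OF r assms(1)])
  have "\<forall>\<^sub>F d in gen. nat_part (d b) \<le> nat_part (d (htimes r b))"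
    using htimes_nat[OF r assms(1)] hnat_pos[OF r] by eventually_elim simp
  then have le: "hle b (htimes r b)" using hle_iff[OF assms(1) rb] by blast
  have pre: "cls V -` ?E \<inter> ?H = saturation \<inter> ?H"
  proof (rule set_eqI)
    fix c
    show "c \<in> cls V -` ?E \<inter> ?H \<longleftrightarrow> c \<in> saturation \<inter> ?H"
      using cls_vseg_hseg(2)[OF assms(1) rb le, of c] cls_in_image_iff[of c]
      by (auto simp: hseg_def)
  qed
  have "?E \<subseteq> cls V ` ?H" using cls_vseg_hseg(1)[OF assms(1) rb le] by blast
  then show ?thesis
    unfolding dens_def using L.emeasure_cls_measure[of ?E V] pre saturation_measurable[OF assms] by simp
qed

text \<open>The intervals used for the right density at \<open>y\<close> start at a point equivalent to \<open>y\<close>, those for the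
  left density end at one; \<open>near b r y\<close> holds for the interval from \<open>b\<close> to \<open>r b\<close> in both cases.\<close>

definition near :: "'h \<Rightarrow> 'h \<Rightarrow> 'h \<Rightarrow> bool" where
  "near b r y \<longleftrightarrow> (\<exists>u\<in>V. \<forall>\<^sub>F d in gen. nat_part (d b) \<le> nat_part (d u) * nat_part (d y) \<and>
    nat_part (d y) \<le> nat_part (d u) * nat_part (d r) * nat_part (d b))"

lemma right_measure_eq_dens:
  assumes y: "y \<in> hnat"
  obtains b where "b \<in> hnat" "\<And>r. r \<in> hnat - V \<Longrightarrow> right_measure V (cls V y) r (cls V ` iset \<alpha>) = dens b r"
    "\<And>r. r \<in> hnat - V \<Longrightarrow> near b r y"
proof -
  define b where "b = (SOME b. b \<in> cls V y)"
  have "b \<in> cls V y" unfolding b_def using cls_mem[OF y] by (rule someI)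
  then have b: "b \<in> hnat" "veq V y b" by (auto simp: cls_def)
  then have cb: "cls V y = cls V b" using cls_eq_iff[OF y] by blast
  obtain u where u: "u \<in> V" "\<forall>\<^sub>F d in gen. nat_part (d y) \<le> nat_part (d u) * nat_part (d b) \<and>
    nat_part (d b) \<le> nat_part (d u) * nat_part (d y)" using b veq_iff[OF y b(1)] by blast
  have "right_measure V (cls V y) r (cls V ` iset \<alpha>) = dens b r" if "r \<in> hnat - V" for r
    unfolding right_measure_def Let_def b_def[symmetric]
    using cls_measure_vseg[OF b(1) that] vtimes_cls[of r b] that b(1) cb by simp
  moreover have "near b r y" if "r \<in> hnat - V" for r
    unfolding near_def
  proof (rule bexI[OF _ u(1)])
    have "r \<in> hnat" using that by simp
    from u(2) hnat_pos[OF this]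
    show "\<forall>\<^sub>F d in gen. nat_part (d b) \<le> nat_part (d u) * nat_part (d y) \<and>
      nat_part (d y) \<le> nat_part (d u) * nat_part (d r) * nat_part (d b)"
    proof eventually_elim
      case (elim d)
      have "nat_part (d u) * nat_part (d b) \<le> nat_part (d u) * nat_part (d r) * nat_part (d b)"
        using elim by simp
      then show ?case using elim by linarith
    qed
  qed
  ultimately show ?thesis using that[of b] b by blast
qed

text \<open>For \<open>r \<le> b\<close> the quotient \<open>b'\<close> is positive and
  \<open>b\<close> lies between \<open>r * b'\<close> and \<open>2 * r * b'\<close>. The interval
  that starts at \<open>b'\<close> with ratio \<open>r\<close> thus ends in the class of
  \<open>y\<close>, and its measure has the same form as on the right. A representative in
  \<open>V\<close> would have no such \<open>r\<close>: every quotient by an \<open>r\<close> above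
  \<open>V\<close> would be 0, outside \<open>hnat\<close>; hence \<open>y\<close> is taken outside
  \<open>V\<close>.\<close>

lemma left_measure_eq_dens:
  assumes y: "y \<in> hnat - V"
  obtains b where "b \<in> hnat - V"
    "\<And>r. r \<in> hnat - V \<Longrightarrow> hle r b \<Longrightarrow> hdiv b r \<in> hnat \<and>
      left_measure V (cls V y) r (cls V ` iset \<alpha>) = dens (hdiv b r) r \<and> near (hdiv b r) r y"
proof -
  have yh: "y \<in> hnat" using y by simp
  define b where "b = (SOME b. b \<in> cls V y)"
  have "b \<in> cls V y" unfolding b_def using cls_mem[OF yh] by (rule someI)
  then have b: "b \<in> hnat" "veq V y b" by (auto simp: cls_def)
  then have cb: "cls V y = cls V b" using cls_eq_iff[OF yh] by blast
  obtain u where u: "u \<in> V" "\<forall>\<^sub>F d in gen. nat_part (d y) \<le> nat_part (d u) * nat_part (d b) \<and>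
    nat_part (d b) \<le> nat_part (d u) * nat_part (d y)" using b veq_iff[OF yh b(1)] by blast
  have "b \<notin> V"
  proof
    assume bV: "b \<in> V"
    have "\<forall>\<^sub>F d in gen. nat_part (d y) \<le> nat_part (d (htimes u b))"
      using u(2) htimes_nat[OF cut_hnat[OF u(1)] b(1)] by eventually_elim simp
    then have "y \<in> V" by (rule cut_down[OF cut_times[OF u(1) bV] yh])
    then show False using y by simp
  qed
  moreover have "hdiv b r \<in> hnat \<and>
      left_measure V (cls V y) r (cls V ` iset \<alpha>) = dens (hdiv b r) r \<and> near (hdiv b r) r y"
    if "r \<in> hnat - V" "hle r b" for r
  proof -
    have r: "r \<in> hnat" using that by simp
    define b' where "b' = hdiv b r"
    have b': "b' \<in> hnat" unfolding b'_def by (rule hdiv_hnat[OF b(1) r that(2)])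
    have "\<forall>\<^sub>F d in gen. nat_part (d r) \<le> nat_part (d b)" using hle_iff[OF r b(1)] that by blast
    then have *: "\<forall>\<^sub>F d in gen. nat_part (d r) * nat_part (d b') \<le> nat_part (d b) \<and>
      nat_part (d b) \<le> 2 * (nat_part (d r) * nat_part (d b'))"
      using hdiv_nat[OF b(1) r] hnat_pos[OF r] hnat_pos[OF b']
    proof eventually_elim
      case (elim d)
      define x z q where "x = nat_part (d b)" and "z = nat_part (d r)" and "q = nat_part (d b')"
      have q: "q = x div z" "1 \<le> q" "1 \<le> z" using elim by (auto simp: x_def z_def q_def b'_def)
      have "x = z * q + x mod z" using q by simp
      moreover have "x mod z < z" using q by simp
      moreover have "z \<le> z * q" using q by simp
      ultimately have "z * q \<le> x \<and> x \<le> 2 * (z * q)" by linarith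
      then show ?case by (simp add: x_def z_def q_def)
    qed
    have rb': "htimes r b' \<in> hnat" by (rule htimes_hnat[OF r b'])
    have "\<forall>\<^sub>F d in gen. nat_part (d b) \<le> nat_part (d (emb (SNat 2))) * nat_part (d (htimes r b')) \<and>
      nat_part (d (htimes r b')) \<le> nat_part (d (emb (SNat 2))) * nat_part (d b)"
      using * htimes_nat[OF r b'] emb_nat[of 2] by eventually_elim simp
    then have "veq V b (htimes r b')" unfolding veq_iff[OF b(1) rb'] by (rule bexI[OF _ two_in_cut])
    then have "cls V b = cls V (htimes r b')" using cls_eq_iff[OF b(1) rb'] by blast
    then have "left_measure V (cls V y) r (cls V ` iset \<alpha>) = dens b' r"
      unfolding left_measure_def Let_def b_def[symmetric] b'_def[symmetric]
      using cls_measure_vseg[OF b' that(1)] cb by simp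
    moreover have "near b' r y"
      unfolding near_def
    proof (rule bexI[OF _ cut_times[OF two_in_cut u(1)]])
      show "\<forall>\<^sub>F d in gen. nat_part (d b') \<le> nat_part (d (htimes (emb (SNat 2)) u)) * nat_part (d y) \<and>
        nat_part (d y) \<le> nat_part (d (htimes (emb (SNat 2)) u)) * nat_part (d r) * nat_part (d b')"
        using * u(2) htimes_nat[OF cut_hnat[OF two_in_cut] cut_hnat[OF u(1)]] emb_nat[of 2] hnat_pos[OF r]
      proof eventually_elim
        case (elim d)
        have "nat_part (d b') \<le> nat_part (d r) * nat_part (d b')" using elim by simp
        then have 1: "nat_part (d b') \<le> 2 * nat_part (d u) * nat_part (d y)" using elim by linarith
        have "nat_part (d y) \<le> nat_part (d u) * nat_part (d b)" using elim by simp
        also have "\<dots> \<le> nat_part (d u) * (2 * (nat_part (d r) * nat_part (d b')))"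
          using elim by (intro mult_le_mono2) simp
        finally show ?case using 1 elim by (simp add: ac_simps)
      qed
    qed
    ultimately show ?thesis using b' b'_def by simp
  qed
  ultimately show ?thesis using that[of b] b by blast
qed

text \<open>Since \<open>b\<close> is free apart from \<open>near\<close>, this one set catches the
  failures on the right and on the left.\<close>

definition bad :: "real \<Rightarrow> 'h set" where
  "bad \<eta> = {y \<in> saturation \<inter> hseg k (htimes N k). \<forall>s\<in>hnat - V. \<exists>r\<in>hnat - V. hless r s \<and>
    (\<exists>b\<in>hnat. near b r y \<and> dens b r < ennreal (1 - \<eta>))}"

lemma bad_null:
  assumes \<eta>: "0 < \<eta>" "\<eta> < 1"
  shows "bad \<eta> \<in> null_sets (loeb k N)"
proof (rule loeb_null)
  fix e :: real assume e: "0 < e"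
  \<comment> \<open>One factor 4 is that of the maximal inequality, the other comes from the
    proportion \<open>\<eta> / 4\<close> in \<open>gap_interval\<close>.\<close>
  define \<epsilon> where "\<epsilon> = e * \<eta> / 16"
  have \<epsilon>: "0 < \<epsilon>" using e \<eta> by (simp add: \<epsilon>_def)
  \<comment> \<open>With the square built into the function, \<open>cut_gap\<close> compares the
    radii \<open>s * s\<close> and \<open>v * v\<close> that \<open>gap_interval\<close> needs,
    while \<open>s\<close> itself remains the threshold for \<open>r\<close>.\<close>
  define F where "F d n = hsum (nbhd (\<alpha> d) (n * n)) / ln (real (nat_part (d N)))" for d n
  have finF: "finitary F"
    unfolding F_def[abs_def]
    by (rule finitary_comp2[OF \<alpha> finitary_coord[of N], of "\<lambda>S u n. hsum (nbhd S (n * n)) / ln (real (nat_part u))"])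
  have F0: "0 \<le> F d n" for d n
    unfolding F_def by (intro divide_nonneg_nonneg hsum_nonneg ln_of_nat_nonneg)
  have F6: "\<forall>\<^sub>F d in gen. \<forall>n. 1 \<le> n \<and> n \<le> nat_part (d N) \<longrightarrow> F d n \<le> 6"
    using ln_large[of 1] large[of 3] hnat_pos[OF k_hnat] \<alpha>_range
  proof eventually_elim
    case (elim d)
    have "F d n \<le> 6" if "1 \<le> n" "n \<le> nat_part (d N)" for n
    proof -
      have "hsum (nbhd (\<alpha> d) (n * n)) \<le> 6 * ln (real (nat_part (d N)))"
        by (rule hsum_nbhd_le[OF elim(4,3) that elim(2)])
      then show ?thesis unfolding F_def using elim(1) by (simp add: divide_le_eq)
    qed
    then show ?case by blast
  qed
  from cut_gap[OF finF F6 F0 \<epsilon>] obtain v s where vs: "v \<in> V" "s \<in> hnat - V"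
    "\<forall>\<^sub>F d in gen. F d (nat_part (d s)) < F d (nat_part (d v)) + \<epsilon>" by blast
  define G where "G d = nbhd (\<alpha> d) (nat_part (d s) * nat_part (d s)) - nbhd (\<alpha> d) (nat_part (d v) * nat_part (d v))" for d
  define B where "B d = {y \<in> range_of d. \<exists>l\<le>y. \<exists>w\<ge>y. \<eta> / 4 * hsum {l..w} \<le> hsum (G d \<inter> {l..w})}" for d
  have finG: "finitary G"
    unfolding G_def[abs_def]
    by (rule finitary_comp3[OF \<alpha> finitary_coord[of s] finitary_coord[of v],
      of "\<lambda>S u w. nbhd S (nat_part u * nat_part u) - nbhd S (nat_part w * nat_part w)"])
  have finB: "finitary B"
    unfolding B_def[abs_def]
    by (rule finitary_comp2[OF finitary_range finG,
      of "\<lambda>R G. {y \<in> R. \<exists>l\<le>y. \<exists>w\<ge>y. \<eta> / 4 * hsum {l..w} \<le> hsum (G \<inter> {l..w})}"])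
  have subB: "\<forall>\<^sub>F d in gen. B d \<subseteq> range_of d" by (simp add: B_def)
  have "mass B \<le> e"
  proof (rule mass_le[OF finB subB])
    show "\<forall>\<^sub>F d in gen. hsum (B d) \<le> e * ln (real (nat_part (d N)))"
      using vs(3) cut_less[OF vs(1,2)] \<alpha>_finite ln_large[of 1]
    proof eventually_elim
      case (elim d)
      have fin: "finite (G d)" "finite (nbhd (\<alpha> d) n)" for n using finite_nbhd[OF elim(3)] by (auto simp: G_def)
      have "\<eta> / 4 * hsum (B d) \<le> 4 * hsum (G d)"
        using \<eta> fin(1) finite_range[of d] by (intro hsum_maximal_inequality) (auto simp: B_def)
      moreover have "hsum (G d) < \<epsilon> * ln (real (nat_part (d N)))"
      proof -
        have "nat_part (d v) * nat_part (d v) \<le> nat_part (d s) * nat_part (d s)"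
          using elim(2) by (intro mult_le_mono) auto
        then have "hsum (G d) = hsum (nbhd (\<alpha> d) (nat_part (d s) * nat_part (d s))) - hsum (nbhd (\<alpha> d) (nat_part (d v) * nat_part (d v)))"
          unfolding G_def by (intro hsum_Diff fin nbhd_mono)
        moreover have "F d (nat_part (d s)) - F d (nat_part (d v)) < \<epsilon>" using elim(1) by simp
        ultimately show ?thesis
          using elim(4) unfolding F_def by (simp add: diff_divide_distrib[symmetric] divide_less_eq)
      qed
      ultimately have "\<eta> / 4 * hsum (B d) \<le> 4 * (\<epsilon> * ln (real (nat_part (d N))))" by linarith
      also have "\<dots> = \<eta> / 4 * (e * ln (real (nat_part (d N))))" by (simp add: \<epsilon>_def)
      finally show ?case using \<eta> by simp
    qed
  qed
  moreover have "bad \<eta> \<subseteq> iset B"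
  proof
    fix y assume y: "y \<in> bad \<eta>"
    \<comment> \<open>Sparse intervals exist for every threshold, but only the \<open>s\<close> from
      \<open>cut_gap\<close> is used; so \<open>B\<close> could be fixed before
      \<open>y\<close>.\<close>
    then obtain r b where rb: "r \<in> hnat - V" "hless r s" "b \<in> hnat" "near b r y" "dens b r < ennreal (1 - \<eta>)"
      using vs(2) unfolding bad_def by blast
    have yY: "y \<in> saturation" "y \<in> iset range_of" using y hseg_iset by (auto simp: bad_def)
    then have yh: "y \<in> hnat" by (simp add: saturation_def)
    obtain a where a: "a \<in> iset \<alpha>" "veq V a y" using yY by (auto simp: saturation_def)
    have ah: "a \<in> hnat" using a iset_\<alpha>_hnat by blast
    have rh: "r \<in> hnat" "s \<in> hnat" using rb vs by auto
    obtain u1 where u1: "u1 \<in> V" "\<forall>\<^sub>F d in gen. nat_part (d a) \<le> nat_part (d u1) * nat_part (d y) \<and>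
      nat_part (d y) \<le> nat_part (d u1) * nat_part (d a)" using a veq_iff[OF ah yh] by blast
    obtain u2 where u2: "u2 \<in> V" "\<forall>\<^sub>F d in gen. nat_part (d b) \<le> nat_part (d u2) * nat_part (d y) \<and>
      nat_part (d y) \<le> nat_part (d u2) * nat_part (d r) * nat_part (d b)" using rb(4) unfolding near_def by blast
    \<comment> \<open>\<open>u1\<close> compares \<open>y\<close> with a point of \<open>A\<close>
      and \<open>u2\<close> compares it with the interval. Their product bounds all the ratios in
      question and, as an element of \<open>V\<close>, stays below \<open>r\<close>.\<close>
    define u where "u = htimes u1 u2"
    have u: "u \<in> V" unfolding u_def by (rule cut_times[OF u1(1) u2(1)])
    interpret L: loeb_interval star b r by (rule loeb_interval_above[OF rb(3,1)])
    define f where "f d = nbhd (\<alpha> d) (nat_part (d v) * nat_part (d v)) \<inter> L.range_of d" for d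
    have finf: "finitary f"
      unfolding f_def[abs_def]
      by (rule finitary_comp3[OF \<alpha> L.finitary_range finitary_coord[of v],
        of "\<lambda>S R u. nbhd S (nat_part u * nat_part u) \<inter> R"])
    have subf: "\<forall>\<^sub>F d in gen. f d \<subseteq> L.range_of d" by (simp add: f_def)
    \<comment> \<open>The square of \<open>v\<close> is in \<open>V\<close>, so the inner
      neighbourhood is part of the saturation and is at most as dense in the interval.\<close>
    have "iset (\<lambda>d. nbhd (\<alpha> d) (nat_part (d v) * nat_part (d v))) = iset (\<lambda>d. nbhd (\<alpha> d) (nat_part (d (htimes v v))))"
      by (rule iset_cong) (use htimes_nat[OF cut_hnat[OF vs(1)] cut_hnat[OF vs(1)]] in eventually_elim, simp)
    then have "iset f \<subseteq> saturation \<inter> hseg b (htimes r b)"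
      unfolding f_def[abs_def] iset_Int L.hseg_iset using nbhd_below[OF cut_times[OF vs(1,1)]] by blast
    then have "emeasure (loeb b r) (iset f) \<le> dens b r"
      unfolding dens_def by (rule emeasure_mono[OF _ saturation_measurable[OF rb(3,1)]])
    then have "ennreal (L.mass f) < ennreal (1 - \<eta>)"
      using rb(5) L.iset_loeb(2)[OF finf subf] by (simp add: order_le_less_trans)
    then have "L.mass f < 1 - \<eta>" using L.mass_nonneg[OF finf subf] by (simp add: ennreal_less_iff)
    then have small: "\<forall>\<^sub>F d in gen. hsum (f d) < (1 - \<eta>) * ln (real (nat_part (d r)))"
      by (rule L.mass_less[OF finf subf])
    have aa: "\<forall>\<^sub>F d in gen. d a = SNat (nat_part (d a)) \<and> nat_part (d a) \<in> \<alpha> d" using a(1) by (simp add: iset_def)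
    have yy: "\<forall>\<^sub>F d in gen. d y = SNat (nat_part (d y)) \<and> nat_part (d y) \<in> range_of d" using yY(2) by (simp add: iset_def)
    have rs: "\<forall>\<^sub>F d in gen. nat_part (d r) < nat_part (d s)" using hless_iff[OF rh] rb(2) by blast
    have pos: "\<forall>\<^sub>F d in gen. 1 \<le> nat_part (d b) \<and> 1 \<le> nat_part (d y) \<and> 1 \<le> nat_part (d u1) \<and> 1 \<le> nat_part (d u2)"
      using hnat_pos[OF rb(3)] hnat_pos[OF yh] hnat_pos[OF cut_hnat[OF u1(1)]] hnat_pos[OF cut_hnat[OF u2(1)]]
      by eventually_elim simp
    show "y \<in> iset B"
      unfolding iset_def mem_Collect_eq
      using u1(2) u2(2) htimes_nat[OF cut_hnat[OF u1(1)] cut_hnat[OF u2(1)]] cut_less[OF u rb(1)]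
        aa yy rs pos small \<alpha>_finite L.large[of 3]
    proof eventually_elim
      case (elim d)
      define a' b' y' r' s' p q where defs: "a' = nat_part (d a)" "b' = nat_part (d b)" "y' = nat_part (d y)"
        "r' = nat_part (d r)" "s' = nat_part (d s)" "p = nat_part (d u1)" "q = nat_part (d u2)"
      have ud: "nat_part (d u) = p * q" using elim by (simp add: u_def defs)
      have h: "a' \<le> p * y'" "y' \<le> p * a'" "b' \<le> q * y'" "y' \<le> q * r' * b'" "1 \<le> p" "1 \<le> q" "1 \<le> b'" "1 \<le> y'"
        using elim by (auto simp: defs)
      have 1: "b' \<le> p * q * a'"
      proof -
        have "b' \<le> q * (p * a')" using h by (meson le_trans mult_le_mono2)
        then show ?thesis by (simp add: ac_simps)
      qed
      have 2: "a' \<le> p * q * r' * b'"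
      proof -
        have "a' \<le> p * (q * r' * b')" using h by (meson le_trans mult_le_mono2)
        then show ?thesis by (simp add: ac_simps)
      qed
      have 3: "b' \<le> p * q * y'"
      proof -
        have "1 * (q * y') \<le> p * (q * y')" using h(5) by (rule mult_le_mono1)
        then show ?thesis using h(3) unfolding mult.assoc by linarith
      qed
      have 4: "y' \<le> p * q * r' * b'"
      proof -
        have "1 * (q * r' * b') \<le> p * (q * r' * b')" using h(5) by (rule mult_le_mono1)
        then show ?thesis using h(4) unfolding mult.assoc by linarith
      qed
      have "\<exists>l\<le>y'. \<exists>w\<ge>y'. \<eta> / 4 * hsum {l..w} \<le> hsum ((nbhd (\<alpha> d) (s' * s') - nbhd (\<alpha> d) (nat_part (d v) * nat_part (d v))) \<inter> {l..w})"
      proof (rule gap_interval[where a = a' and b = b' and r = r' and u = "p * q"])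
        show "finite (\<alpha> d)" "a' \<in> \<alpha> d" "1 \<le> b'" "1 \<le> y'" "1 \<le> p * q" "3 \<le> r'" "r' \<le> s'" "p * q \<le> r'" "0 \<le> \<eta>"
          using elim h \<eta> ud by (auto simp: defs)
        show "hsum (nbhd (\<alpha> d) (nat_part (d v) * nat_part (d v)) \<inter> {b'..r' * b'}) \<le> (1 - \<eta>) * ln (real r')"
          using elim(9) by (simp add: f_def L.range_of_def defs)
      qed (use 1 2 3 4 in simp_all)
      then show ?case using elim by (simp add: B_def G_def defs)
    qed
  qed
  ultimately show "\<exists>f. finitary f \<and> (\<forall>\<^sub>F d in gen. f d \<subseteq> range_of d) \<and> bad \<eta> \<subseteq> iset f \<and> mass f \<le> e"
    using finB subB by blast
qed

text \<open>All of \<open>V\<close> lies below \<open>s\<close>, and \<open>cut_gap\<close> makes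
  the sum up to \<open>s\<close> nearly that up to some \<open>v\<close> in \<open>V\<close>. The
  latter is small since the power of \<open>v\<close> with exponent \<open>Suc m\<close> is still in
  \<open>V\<close>, hence below \<open>N\<close>, which bounds \<open>ln v\<close> by
  \<open>ln N / (m + 1)\<close>.\<close>

lemma cut_null: "V \<inter> hseg k (htimes N k) \<in> null_sets (loeb k N)"
proof (rule loeb_null)
  fix e :: real assume e: "0 < e"
  define F where "F d n = hsum {1..n} / ln (real (nat_part (d N)))" for d :: "'h \<Rightarrow> std" and n
  have finF: "finitary F"
    unfolding F_def[abs_def]
    by (rule finitary_comp[OF finitary_coord[of N], of "\<lambda>u n. hsum {1..n} / ln (real (nat_part u))"])
  have F0: "0 \<le> F d n" for d n
    unfolding F_def by (intro divide_nonneg_nonneg hsum_nonneg ln_of_nat_nonneg)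
  have F2: "\<forall>\<^sub>F d in gen. \<forall>n. 1 \<le> n \<and> n \<le> nat_part (d N) \<longrightarrow> F d n \<le> 2"
    using ln_large[of 1]
  proof eventually_elim
    case (elim d)
    have "F d n \<le> 2" if n: "1 \<le> n" "n \<le> nat_part (d N)" for n
    proof -
      have "hsum {1..n} \<le> 1 + ln (real n)" using hsum_interval_upper[of 1 n] n by simp
      also have "ln (real n) \<le> ln (real (nat_part (d N)))" using n by simp
      finally show ?thesis unfolding F_def using elim by (simp add: divide_le_eq)
    qed
    then show ?case by blast
  qed
  have "0 < e / 4" using e by simp
  from cut_gap[OF finF F2 F0 this] obtain v s where vs: "v \<in> V" "s \<in> hnat - V"
    "\<forall>\<^sub>F d in gen. F d (nat_part (d s)) < F d (nat_part (d v)) + e / 4" by blast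
  define f where "f d = {1..nat_part (d s)} \<inter> range_of d" for d
  have finf: "finitary f"
    unfolding f_def[abs_def]
    by (rule finitary_comp2[OF finitary_range finitary_coord[of s], of "\<lambda>R u. {1..nat_part u} \<inter> R"])
  have subf: "\<forall>\<^sub>F d in gen. f d \<subseteq> range_of d" by (simp add: f_def)
  obtain m :: nat where m: "4 / e < real m" using reals_Archimedean2 by blast
  obtain w where w: "w \<in> V" "\<forall>\<^sub>F d in gen. nat_part (d w) = nat_part (d v) ^ Suc m"
    by (rule cut_power[OF vs(1)])
  have "mass f \<le> e"
  proof (rule mass_le[OF finf subf])
    show "\<forall>\<^sub>F d in gen. hsum (f d) \<le> e * ln (real (nat_part (d N)))"
      \<comment> \<open>Three errors, each at most \<open>e / 4\<close> of \<open>ln N\<close>: the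
        gap, \<open>ln v\<close> by the choice of \<open>m\<close>, and the additive
        \<open>1\<close> once \<open>ln N\<close> is at least \<open>4 / e\<close>.\<close>
      using vs(3) w(2) cut_less[OF w(1) above] ln_large[of "1 + 4 / e"] hnat_pos[OF cut_hnat[OF vs(1)]]
    proof eventually_elim
      case (elim d)
      define L where "L = ln (real (nat_part (d N)))"
      define x where "x = nat_part (d v)"
      have L: "1 + 4 / e \<le> L" using elim(4) by (simp add: L_def)
      have "0 < 4 / e" using e by simp
      then have L1: "0 < L" using L by linarith
      have "real x ^ Suc m \<le> real (nat_part (d N))"
        using elim(2,3) unfolding x_def by (metis less_imp_le of_nat_le_iff of_nat_power)
      then have "ln (real x ^ Suc m) \<le> L"
        unfolding L_def using elim(5) by (intro ln_mono) (auto simp: x_def)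
      then have "real (Suc m) * ln (real x) \<le> L"
        using elim(5) by (simp only: ln_realpow x_def)
      moreover have "4 / e * ln (real x) \<le> real (Suc m) * ln (real x)"
        using m ln_of_nat_nonneg[of x] by (intro mult_right_mono) auto
      ultimately have "4 / e * ln (real x) \<le> L" by linarith
      then have lnx: "ln (real x) \<le> e / 4 * L" using e by (simp add: field_simps)
      have one: "1 \<le> e / 4 * L" using L e by (simp add: field_simps)
      have "hsum (f d) \<le> hsum {1..nat_part (d s)}" unfolding f_def by (intro hsum_mono) auto
      also have "\<dots> \<le> hsum {1..x} + e / 4 * L"
      proof -
        have "hsum {1..nat_part (d s)} / L < hsum {1..x} / L + e / 4" using elim(1) by (simp add: F_def L_def x_def)
        then show ?thesis using L1 by (simp add: field_simps)
      qed
      also have "hsum {1..x} \<le> 1 + ln (real x)" using hsum_interval_upper[of 1 x] elim(5) by (simp add: x_def)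
      finally show ?case using lnx one unfolding L_def[symmetric] by linarith
    qed
  qed
  moreover have "V \<inter> hseg k (htimes N k) \<subseteq> iset f"
  proof
    fix y assume y: "y \<in> V \<inter> hseg k (htimes N k)"
    then have "y \<in> iset range_of" using hseg_iset by blast
    then have "\<forall>\<^sub>F d in gen. d y = SNat (nat_part (d y)) \<and> nat_part (d y) \<in> range_of d" by (simp add: iset_def)
    moreover have "\<forall>\<^sub>F d in gen. nat_part (d y) < nat_part (d s)" using y cut_less[OF _ vs(2)] by blast
    moreover have "\<forall>\<^sub>F d in gen. 1 \<le> nat_part (d y)" using y cut_hnat hnat_pos by blast
    ultimately show "y \<in> iset f" unfolding iset_def mem_Collect_eq by eventually_elim (simp add: f_def)
  qed
  ultimately show "\<exists>f. finitary f \<and> (\<forall>\<^sub>F d in gen. f d \<subseteq> range_of d) \<and> V \<inter> hseg k (htimes N k) \<subseteq> iset f \<and> mass f \<le> e"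
    using finf subf by blast
qed

text \<open>The first assumption bounds the supremum by 1, so being different from 1 means a
  definite shortfall. It asks for one good \<open>r\<close> below each \<open>s\<close> because left
  measures are controlled only for \<open>r\<close> up to the representative \<open>b\<close>. The
  shortfalls \<open>1 / (real n + 2)\<close> form a countable family strictly between 0 and
  1.\<close>

lemma liminf_neq_1_bound:
  fixes \<mu> :: "'h \<Rightarrow> ennreal"
  assumes le: "\<And>s. s \<in> hnat - V \<Longrightarrow> \<exists>r\<in>hnat - V. hless r s \<and> \<mu> r \<le> 1"
    and ne: "(SUP s\<in>hnat - V. INF r\<in>{r \<in> hnat - V. hless r s}. \<mu> r) \<noteq> 1"
  obtains n :: nat where "\<And>s. s \<in> hnat - V \<Longrightarrow> \<exists>r\<in>hnat - V. hless r s \<and> \<mu> r < ennreal (1 - 1 / (real n + 2))"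
proof -
  let ?S = "SUP s\<in>hnat - V. INF r\<in>{r \<in> hnat - V. hless r s}. \<mu> r"
  have "?S \<le> 1"
  proof (rule SUP_least)
    fix s assume "s \<in> hnat - V"
    then obtain r where "r \<in> hnat - V" "hless r s" "\<mu> r \<le> 1" using le by blast
    then show "(INF r\<in>{r \<in> hnat - V. hless r s}. \<mu> r) \<le> 1" by (intro INF_lower2[of r]) auto
  qed
  then have "?S < 1" using ne by (simp add: order_less_le)
  then obtain q where q: "?S < q" "q < 1" using dense by blast
  obtain q' where q0: "q = ennreal q'" "0 \<le> q'" using q(2) by (cases q) auto
  then have q': "q = ennreal q'" "0 \<le> q'" "q' < 1" using q(2) by (auto simp: ennreal_less_one_iff)
  obtain n :: nat where n: "1 / (1 - q') < real n" using reals_Archimedean2 by blast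
  have "q' \<le> 1 - 1 / (real n + 2)"
  proof -
    have "1 / (real n + 2) \<le> 1 - q'"
    proof -
      have "1 < real n * (1 - q')" using n q' by (simp add: field_simps)
      also have "\<dots> \<le> (real n + 2) * (1 - q')" using q' by (intro mult_right_mono) auto
      finally show ?thesis by (simp add: field_simps)
    qed
    then show ?thesis by simp
  qed
  then have qn: "q \<le> ennreal (1 - 1 / (real n + 2))" using q' by (simp add: ennreal_leI)
  have "\<exists>r\<in>hnat - V. hless r s \<and> \<mu> r < ennreal (1 - 1 / (real n + 2))" if "s \<in> hnat - V" for s
  proof -
    have "(INF r\<in>{r \<in> hnat - V. hless r s}. \<mu> r) \<le> ?S" using that by (rule SUP_upper)
    then have "(INF r\<in>{r \<in> hnat - V. hless r s}. \<mu> r) < q" using q(1) by simp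
    then obtain r where "r \<in> hnat - V" "hless r s" "\<mu> r < q" unfolding INF_less_iff by blast
    then show ?thesis using qn by (meson order_less_le_trans)
  qed
  then show ?thesis using that by blast
qed

lemma not_density_point_bad:
  assumes y: "y \<in> saturation" "y \<in> hseg k (htimes N k)" "y \<notin> V"
    and "\<not> density_point V (cls V ` iset \<alpha>) (cls V y)"
  obtains n :: nat where "y \<in> bad (1 / (real n + 2))"
proof -
  have yh: "y \<in> hnat" using y by (simp add: saturation_def)
  have yV: "y \<in> hnat - V" using yh y by simp
  consider "right_density V (cls V y) (cls V ` iset \<alpha>) \<noteq> 1" | "left_density V (cls V y) (cls V ` iset \<alpha>) \<noteq> 1"
    using assms(4) unfolding density_point_def by blast
  then show ?thesis
  proof cases
    case 1
    obtain b where b: "b \<in> hnat"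
      "\<And>r. r \<in> hnat - V \<Longrightarrow> right_measure V (cls V y) r (cls V ` iset \<alpha>) = dens b r"
      "\<And>r. r \<in> hnat - V \<Longrightarrow> near b r y"
      using right_measure_eq_dens[OF yh] by blast
    have "\<exists>r\<in>hnat - V. hless r s \<and> right_measure V (cls V y) r (cls V ` iset \<alpha>) \<le> 1" if "s \<in> hnat - V" for s
      using above_cut_smaller[OF that] b(2) dens_le_1[OF b(1)] by metis
    then obtain n :: nat where n: "\<And>s. s \<in> hnat - V \<Longrightarrow> \<exists>r\<in>hnat - V. hless r s \<and>
      right_measure V (cls V y) r (cls V ` iset \<alpha>) < ennreal (1 - 1 / (real n + 2))"
      using liminf_neq_1_bound[of "\<lambda>r. right_measure V (cls V y) r (cls V ` iset \<alpha>)"] 1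
      unfolding right_density_def by blast
    have "y \<in> bad (1 / (real n + 2))"
      unfolding bad_def
    proof (intro CollectI conjI ballI IntI y(1,2))
      fix s assume "s \<in> hnat - V"
      then obtain r where r: "r \<in> hnat - V" "hless r s"
        "right_measure V (cls V y) r (cls V ` iset \<alpha>) < ennreal (1 - 1 / (real n + 2))" using n by blast
      then have "dens b r < ennreal (1 - 1 / (real n + 2))" using b(2) by simp
      then show "\<exists>r\<in>hnat - V. hless r s \<and> (\<exists>b\<in>hnat. near b r y \<and> dens b r < ennreal (1 - 1 / (real n + 2)))"
        using r(1,2) b(1,3) by blast
    qed
    then show ?thesis using that by blast
  next
    case 2
    obtain b where b: "b \<in> hnat - V"
      "\<And>r. r \<in> hnat - V \<Longrightarrow> hle r b \<Longrightarrow> hdiv b r \<in> hnat \<and>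
        left_measure V (cls V y) r (cls V ` iset \<alpha>) = dens (hdiv b r) r \<and> near (hdiv b r) r y"
      using left_measure_eq_dens[OF yV] by blast
    have bh: "b \<in> hnat" using b by simp
    \<comment> \<open>\<open>t\<close> is the smaller of \<open>s\<close> and \<open>b\<close>;
      below it the left measures are given by \<open>dens\<close>.\<close>
    have min_below: "\<exists>t\<in>hnat - V. \<forall>r\<in>hnat. hless r t \<longrightarrow> hless r s \<and> hle r b" if s: "s \<in> hnat - V" for s
    proof (cases "hle s b")
      case True
      have sh: "s \<in> hnat" using s by simp
      have "hle r b" if "r \<in> hnat" "hless r s" for r
      proof -
        have "\<forall>\<^sub>F d in gen. nat_part (d r) < nat_part (d s)" using hless_iff[OF that(1) sh] that by blast
        moreover have "\<forall>\<^sub>F d in gen. nat_part (d s) \<le> nat_part (d b)" using hle_iff[OF sh bh] True by blast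
        ultimately have "\<forall>\<^sub>F d in gen. nat_part (d r) \<le> nat_part (d b)" by eventually_elim simp
        then show ?thesis using hle_iff[OF that(1) bh] by blast
      qed
      then show ?thesis using s by blast
    next
      case False
      have sh: "s \<in> hnat" using s by simp
      have "hless r s \<and> hle r b" if "r \<in> hnat" "hless r b" for r
      proof -
        have "\<forall>\<^sub>F d in gen. nat_part (d r) < nat_part (d b)" using hless_iff[OF that(1) bh] that by blast
        moreover have "\<forall>\<^sub>F d in gen. nat_part (d b) < nat_part (d s)" using not_hle_iff[OF sh bh] False by blast
        ultimately have "\<forall>\<^sub>F d in gen. nat_part (d r) < nat_part (d s)" by eventually_elim simp
        then show ?thesis using hless_iff[OF that(1) sh] that(2) by (simp add: hless_def)
      qed
      then show ?thesis using b(1) by blast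
    qed
    have "\<exists>r\<in>hnat - V. hless r s \<and> left_measure V (cls V y) r (cls V ` iset \<alpha>) \<le> 1" if s: "s \<in> hnat - V" for s
    proof -
      obtain t where t: "t \<in> hnat - V" "\<And>r. r \<in> hnat \<Longrightarrow> hless r t \<Longrightarrow> hless r s \<and> hle r b"
        using min_below[OF s] by blast
      obtain r where r: "r \<in> hnat - V" "hless r t" by (rule above_cut_smaller[OF t(1)])
      then have *: "hless r s" "hle r b" using t(2)[of r] by auto
      then have "left_measure V (cls V y) r (cls V ` iset \<alpha>) \<le> 1"
        using b(2)[OF r(1)] dens_le_1[OF _ r(1)] by simp
      then show ?thesis using r(1) * by blast
    qed
    then obtain n :: nat where n: "\<And>s. s \<in> hnat - V \<Longrightarrow> \<exists>r\<in>hnat - V. hless r s \<and>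
      left_measure V (cls V y) r (cls V ` iset \<alpha>) < ennreal (1 - 1 / (real n + 2))"
      using liminf_neq_1_bound[of "\<lambda>r. left_measure V (cls V y) r (cls V ` iset \<alpha>)"] 2
      unfolding left_density_def by blast
    have "y \<in> bad (1 / (real n + 2))"
      unfolding bad_def
    proof (intro CollectI conjI ballI IntI y(1,2))
      fix s assume s: "s \<in> hnat - V"
      obtain t where t: "t \<in> hnat - V" "\<And>r. r \<in> hnat \<Longrightarrow> hless r t \<Longrightarrow> hless r s \<and> hle r b"
        using min_below[OF s] by blast
      obtain r where r: "r \<in> hnat - V" "hless r t"
        "left_measure V (cls V y) r (cls V ` iset \<alpha>) < ennreal (1 - 1 / (real n + 2))" using n[OF t(1)] by blast
      then have *: "hless r s" "hle r b" using t(2)[of r] by auto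
      then have "hdiv b r \<in> hnat" "near (hdiv b r) r y" "dens (hdiv b r) r < ennreal (1 - 1 / (real n + 2))"
        using b(2)[OF r(1)] r(3) by auto
      then show "\<exists>r\<in>hnat - V. hless r s \<and> (\<exists>b\<in>hnat. near b r y \<and> dens b r < ennreal (1 - 1 / (real n + 2)))"
        using r(1) *(1) by blast
    qed
    then show ?thesis using that by blast
  qed
qed

text \<open>The preimage of the exceptional classes lies in \<open>V\<close> together with countably
  many sets \<open>bad\<close>. Completeness makes the preimage itself measurable, which is what
  qualifies \<open>E\<close> as a measurable set of classes.\<close>

theorem almost_every_density_point:
  "AE x in cls_measure k N V. x \<in> cls V ` iset \<alpha> \<longrightarrow> density_point V (cls V ` iset \<alpha>) x"
proof -
  let ?X = "cls V ` iset \<alpha>"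
  let ?H = "hseg k (htimes N k)"
  define E where "E = {x \<in> cls V ` ?H. x \<in> ?X \<and> \<not> density_point V ?X x}"
  have "cls V -` E \<inter> ?H \<subseteq> V \<inter> ?H \<union> (\<Union>n. bad (1 / (real n + 2)))"
  proof
    fix y assume y: "y \<in> cls V -` E \<inter> ?H"
    then have yh: "y \<in> hnat" by (simp add: hseg_def)
    have "y \<in> saturation" "\<not> density_point V ?X (cls V y)"
      using y cls_in_image_iff[OF yh] by (auto simp: E_def)
    then show "y \<in> V \<inter> ?H \<union> (\<Union>n. bad (1 / (real n + 2)))"
      using y not_density_point_bad[of y] by blast
  qed
  moreover have "V \<inter> ?H \<union> (\<Union>n::nat. bad (1 / (real n + 2))) \<in> null_sets (loeb k N)"
    by (intro null_sets.Un cut_null null_sets_UN bad_null) auto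
  ultimately have null: "cls V -` E \<inter> ?H \<in> null_sets (loeb k N)"
    unfolding loeb_eq by (rule null_sets_completion_subset)
  have ES: "E \<in> {E. E \<subseteq> cls V ` ?H \<and> cls V -` E \<inter> ?H \<in> sets (loeb k N)}"
    using null unfolding E_def by blast
  have "E \<in> null_sets (cls_measure k N V)"
    using emeasure_cls_measure[OF ES] sets_cls_measure[of V] ES null by (auto simp: null_sets_def)
  then show ?thesis
    by (rule AE_I') (auto simp: E_def space_cls_measure)
qed

end

theorem theorem5p1:
  fixes star :: "std list set \<Rightarrow> 'h list set"
    and N k :: 'h and V A :: "'h set" and X :: "'h set set"
  assumes "nonstd star"
    and "nonstd.hinfinite star N"
    and "nonstd.mult_cut star V"
    and "V \<subseteq> nonstd.hseg star (nonstd.emb star (SNat 1)) N"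
    and "k \<in> nonstd.hnat star"
    and "internal star A"
    and "A \<subseteq> nonstd.hseg star k (nonstd.htimes star N k)"
    and "X = nonstd.cls star V ` A"
  shows "AE x in nonstd.cls_measure star k N V.
           x \<in> X \<longrightarrow> nonstd.density_point star V X x"
proof -
  interpret nonstd star by fact
  have N: "N \<in> hnat" using assms(2) unfolding hinfinite_def by blast
  have two: "hless (emb (SNat 1)) N" using assms(2) unfolding hinfinite_def by blast
  \<comment> \<open>Closure under products would put \<open>N * N\<close> into \<open>V\<close>, so
    at most \<open>N\<close>, although \<open>N\<close> exceeds 1.\<close>
  have "N \<notin> V"
  proof
    assume "N \<in> V"
    then have "htimes N N \<in> V" using assms(3) unfolding mult_cut_def by blast
    then have "hle (htimes N N) N" using assms(4) unfolding hseg_def by blast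
    then have "\<forall>\<^sub>F d in gen. nat_part (d (htimes N N)) \<le> nat_part (d N)"
      using hle_iff[OF htimes_hnat[OF N N] N] by blast
    moreover have "\<forall>\<^sub>F d in gen. nat_part (d (emb (SNat 1))) < nat_part (d N)"
      using two hless_iff[OF _ N] emb_hnat by blast
    ultimately have "\<forall>\<^sub>F d in gen. False"
      using htimes_nat[OF N N] emb_nat[of 1] by eventually_elim simp
    then show False by simp
  qed
  then interpret nonstd_cut star V N using assms(3) N by unfold_locales auto
  interpret L: loeb_interval star k N using loeb_interval_above[OF assms(5) above] .
  have "A \<in> L.internals" using assms(6,7) by (simp add: L.internals_def)
  then obtain f where f: "finitary f" "\<forall>\<^sub>F d in gen. f d \<subseteq> L.range_of d" "A = iset f"
    by (rule L.internalsE)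
  interpret internal_cut star V N k f
    by unfold_locales (use assms(5) f in \<open>simp_all add: L.range_of_def\<close>)
  show ?thesis using almost_every_density_point assms(8) f(3) by simp
qed

end
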